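(* Let $\Lambda=\Lambda(\Omega)$ be a model set, $Q$ a linear similarity compatible with $\Lambda$, $A=Q^*$, let $f\in\mathcal C(\Omega)$ be the function on internal space corresponding to the $Q$-invariant density of $\Lambda$, and let $\mu_f$ be the measure $\mu_f(Y)=\int_Y f(x)\,dx$ on $\mathbb R^n$. For $s>0$ let $\mu_s$ be the Hutchinson measure of the finite family of maps $t_v^*$, $v\in T_s$. Then: (i) for any $s>0$, $\hat\mu_s(k)=\prod_{N=0}^\infty g_s\big((A^t)^Nk\big)$ for $k\in\mathbb R^n$, where $g_s(k)=\frac1{\#T_s}\sum_{v\in T_s}e^{-2\pi ik\cdot v^*}$; (ii) $\hat\mu_s\to\hat\mu_f$ as $s\to\infty$, where the convergence is uniform on compact sets; (iii) $\mu_s\to\mu_f$ as $s\to\infty$ in the sense of weak convergence, i.e. $\mu_s(\varphi)\to\mu_f(\varphi)$ for all $\varphi\in\mathcal C(\Omega)$.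
   Context: Cut and project scheme: $\mathbb R^m$ (physical space) and $\mathbb R^n$ (internal space) are Euclidean spaces, $\mathbb R^m\times\mathbb R^n$ is their orthogonal sum, $\pi_1,\pi_2$ are the projections onto $\mathbb R^m$ and $\mathbb R^n$, and $\tilde L\subset\mathbb R^m\times\mathbb R^n$ is a lattice such that $\pi_1|_{\tilde L}$ is injective and $\pi_2(\tilde L)$ is dense in $\mathbb R^n$. Put $L=\pi_1(\tilde L)$ and let $(\,)^*=\pi_2\circ(\pi_1|_{\tilde L})^{-1}:L\to\mathbb R^n$. For $\Omega\subset\mathbb R^n$, $\Lambda(\Omega)=\{x\in L\mid x^*\in\Omega\}$; it is a model set if $\Omega$ is compact, $\Omega=\overline{\mathrm{int}(\Omega)}$, and $\partial\Omega$ has Lebesgue measure $0$. Standing assumptions: $0\in\Lambda$ and $0\in\mathrm{int}(\Omega)$. A linear similarity is $Q=qR$ with $R$ an orthogonal transformation of $\mathbb R^m$ and $q$ real. It is assumed that $QL=L$. Then $Q$ induces an automorphism of the lattice $\tilde L$ and a linear map $A=Q^*$ of $\mathbb R^n$ with $(Qx)^*=A(x^* )$ for $x\in L$; $A$ maps $\Omega$ into itself and is diagonalizable over $\mathbb C$, and it is assumed that all its eigenvalues have absolute value less than $1$. Define $\Omega_Q=\{u\in\mathbb R^n\mid A\Omega+u\subset\Omega\}$. $Q$ is compatible with $\Lambda$ if $\mathrm{int}(\Omega_Q)\neq\emptyset$. It is always assumed that $\partial\Omega_Q$ has Lebesgue measure $0$. Put $T=T_Q=\{v\in L\mid v^*\in\Omega_Q\}$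 and $T_s=\{v\in T\mid|v|\le s\}$, a finite set (nonempty, since $0\in T$). For $v\in T$ let $t_v^*:\mathbb R^n\to\mathbb R^n$, $t_v^*(y)=Ay+v^*$; it maps $\Omega$ into $\Omega$. $\#$ denotes cardinality. $\mathcal C(\Omega)$ is the space of continuous complex-valued functions on $\mathbb R^n$ with support in $\Omega$. The function $f$ of the $Q$-invariant density is the unique non-negative $f\in\mathcal C(\Omega)$ with $\int_{\mathbb R^n}f(u)\,du=1$ and $$f(x)=\frac1{|\det(A)|\,\mathrm{vol}(\Omega_Q)}\int_{\Omega_Q}f(A^{-1}(x-u))\,du ;$$ equivalently, $\hat f(k)=\prod_{N=0}^\infty\hat{\mathbf 1}_{\Omega_Q}((A^t)^Nk)/\mathrm{vol}(\Omega_Q)$, with $\hat f(k)=\int_{\mathbb R^n}e^{-2\pi ik\cdot x}f(x)\,dx$. Hutchinson measure: for a measure $\mu$ put $(t_v^*\cdot\mu)(Y)=\mu((t_v^* )^{-1}(Y))$. For each $s>0$, $\mu_s$ is the unique non-negative Borel measure on $\Omega$ with $\mu_s(\Omega)=1$ and $$\mu_s=\frac1{\#T_s}\sum_{v\in T_s}t_v^*\cdot\mu_s .$$ For a finite measure $\mu$ on $\mathbb R^n$, $\hat\mu(k)=\int e^{-2\pi ik\cdot x}\,d\mu(x)$, and $\mu(\varphi)=\int\varphi\,d\mu$. *)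

theory Defs
  imports "HOL-Analysis.Analysis"
begin

section \<open>Cut and project schemes and model sets\<close>

definition is_lattice :: "'a::euclidean_space set \<Rightarrow> bool" where
  "is_lattice \<Gamma> \<longleftrightarrow> (\<exists>B. independent B \<and> span B = UNIV \<and>
     \<Gamma> = range (\<lambda>c :: 'a \<Rightarrow> int. \<Sum>b\<in>B. of_int (c b) *\<^sub>R b))"

definition cut_and_project :: "((real^'m) \<times> (real^'n)) set \<Rightarrow> bool" where
  "cut_and_project \<Gamma> \<longleftrightarrow> is_lattice \<Gamma> \<and> inj_on fst \<Gamma> \<and> closure (snd ` \<Gamma>) = UNIV"

definition phys :: "((real^'m) \<times> (real^'n)) set \<Rightarrow> (real^'m) set" where
  "phys \<Gamma> = fst ` \<Gamma>"

text \<open>Only meaningful for arguments in \<^term>\<open>phys \<Gamma>\<close>.\<close>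

definition star :: "((real^'m) \<times> (real^'n)) set \<Rightarrow> real^'m \<Rightarrow> real^'n" where
  "star \<Gamma> x = snd (the_inv_into \<Gamma> fst x)"

definition Lam :: "((real^'m) \<times> (real^'n)) set \<Rightarrow> (real^'n) set \<Rightarrow> (real^'m) set" where
  "Lam \<Gamma> \<Omega> = {x \<in> phys \<Gamma>. star \<Gamma> x \<in> \<Omega>}"

definition model_set_window :: "(real^'n) set \<Rightarrow> bool" where
  "model_set_window \<Omega> \<longleftrightarrow>
     compact \<Omega> \<and> \<Omega> = closure (interior \<Omega>) \<and> frontier \<Omega> \<in> null_sets lborel"

section \<open>Similarities and the induced map on internal space\<close>

definition linear_similarity :: "(real^'m \<Rightarrow> real^'m) \<Rightarrow> bool" where
  "linear_similarity Q \<longleftrightarrow> (\<exists>q R. orthogonal_transformation R \<and> Q = (\<lambda>x. q *\<^sub>R R x))"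

text \<open>Since the star image of \<^term>\<open>phys \<Gamma>\<close> is dense in a cut and project scheme,
  at most one linear \<^term>\<open>A\<close> is the internal map of a given \<^term>\<open>Q\<close>.\<close>

definition internal_map ::
  "((real^'m) \<times> (real^'n)) set \<Rightarrow> (real^'m \<Rightarrow> real^'m) \<Rightarrow> (real^'n \<Rightarrow> real^'n) \<Rightarrow> bool" where
  "internal_map \<Gamma> Q A \<longleftrightarrow> linear A \<and> (\<forall>x\<in>phys \<Gamma>. star \<Gamma> (Q x) = A (star \<Gamma> x))"

definition complex_matrix :: "(real^'n \<Rightarrow> real^'n) \<Rightarrow> complex^'n^'n" where
  "complex_matrix A = (\<chi> i j. complex_of_real (matrix A $ i $ j))"

definition complex_eigenvalue :: "(real^'n \<Rightarrow> real^'n) \<Rightarrow> complex \<Rightarrow> bool" where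
  "complex_eigenvalue A c \<longleftrightarrow> (\<exists>v. v \<noteq> 0 \<and> complex_matrix A *v v = c *s v)"

definition complex_diagonalizable :: "(real^'n \<Rightarrow> real^'n) \<Rightarrow> bool" where
  "complex_diagonalizable A \<longleftrightarrow> (\<exists>(P :: complex^'n^'n) (D :: complex^'n^'n).
     invertible P \<and> (\<forall>i j. i \<noteq> j \<longrightarrow> D $ i $ j = 0) \<and>
     complex_matrix A = P ** D ** matrix_inv P)"

definition Omega_Q :: "(real^'n \<Rightarrow> real^'n) \<Rightarrow> (real^'n) set \<Rightarrow> (real^'n) set" where
  "Omega_Q A \<Omega> = {u. (\<lambda>y. A y + u) ` \<Omega> \<subseteq> \<Omega>}"

definition compatible :: "(real^'n \<Rightarrow> real^'n) \<Rightarrow> (real^'n) set \<Rightarrow> bool" where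
  "compatible A \<Omega> \<longleftrightarrow> interior (Omega_Q A \<Omega>) \<noteq> {}"

definition T_set ::
  "((real^'m) \<times> (real^'n)) set \<Rightarrow> (real^'n \<Rightarrow> real^'n) \<Rightarrow> (real^'n) set \<Rightarrow> real \<Rightarrow> (real^'m) set" where
  "T_set \<Gamma> A \<Omega> s = {v \<in> Lam \<Gamma> (Omega_Q A \<Omega>). norm v \<le> s}"

definition t_star ::
  "((real^'m) \<times> (real^'n)) set \<Rightarrow> (real^'n \<Rightarrow> real^'n) \<Rightarrow> real^'m \<Rightarrow> real^'n \<Rightarrow> real^'n" where
  "t_star \<Gamma> A v y = A y + star \<Gamma> v"

section \<open>Invariant densities, Hutchinson measures, Fourier transforms\<close>

definition C_space :: "(real^'n) set \<Rightarrow> (real^'n \<Rightarrow> complex) set" where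
  "C_space \<Omega> = {\<phi>. continuous_on UNIV \<phi> \<and> closure {x. \<phi> x \<noteq> 0} \<subseteq> \<Omega>}"

text \<open>A non-negative element of \<^term>\<open>C_space \<Omega>\<close> is given as a real-valued function.\<close>

definition invariant_density ::
  "(real^'n \<Rightarrow> real^'n) \<Rightarrow> (real^'n) set \<Rightarrow> (real^'n \<Rightarrow> real) \<Rightarrow> bool" where
  "invariant_density A \<Omega> f \<longleftrightarrow>
     (\<lambda>x. complex_of_real (f x)) \<in> C_space \<Omega> \<and> (\<forall>x. 0 \<le> f x) \<and> (LINT u|lborel. f u) = 1 \<and>
     (\<forall>x. f x = 1 / (\<bar>det (matrix A)\<bar> * measure lborel (Omega_Q A \<Omega>)) *
                (LINT u:Omega_Q A \<Omega>|lborel. f (inv A (x - u))))"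

text \<open>A Borel probability measure on \<^term>\<open>\<Omega>\<close> is represented as a Borel measure on the whole
  space for which the complement of \<^term>\<open>\<Omega>\<close> is null.  The sum runs over the index
  set \<^term>\<open>T_set \<Gamma> A \<Omega> s\<close>, so that maps occurring for several \<^term>\<open>v\<close> are counted
  with multiplicity.\<close>

definition hutchinson_measure ::
  "((real^'m) \<times> (real^'n)) set \<Rightarrow> (real^'n \<Rightarrow> real^'n) \<Rightarrow> (real^'n) set \<Rightarrow> real
     \<Rightarrow> (real^'n) measure \<Rightarrow> bool" where
  "hutchinson_measure \<Gamma> A \<Omega> s M \<longleftrightarrow>
     sets M = sets borel \<and> emeasure M (- \<Omega>) = 0 \<and> emeasure M \<Omega> = 1 \<and>
     (\<forall>Y\<in>sets borel. measure M Y =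
        1 / real (card (T_set \<Gamma> A \<Omega> s)) *
          (\<Sum>v\<in>T_set \<Gamma> A \<Omega> s. measure (distr M borel (t_star \<Gamma> A v)) Y))"

definition fourier :: "(real^'n) measure \<Rightarrow> real^'n \<Rightarrow> complex" where
  "fourier M k = (LINT x|M. exp (- (2 * of_real pi * \<i>) * of_real (k \<bullet> x)))"

definition g_fun ::
  "((real^'m) \<times> (real^'n)) set \<Rightarrow> (real^'n \<Rightarrow> real^'n) \<Rightarrow> (real^'n) set \<Rightarrow> real
     \<Rightarrow> real^'n \<Rightarrow> complex" where
  "g_fun \<Gamma> A \<Omega> s k = 1 / of_nat (card (T_set \<Gamma> A \<Omega> s)) *
     (\<Sum>v\<in>T_set \<Gamma> A \<Omega> s. exp (- (2 * of_real pi * \<i>) * of_real (k \<bullet> star \<Gamma> v)))"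

definition density_measure :: "(real^'n \<Rightarrow> real) \<Rightarrow> (real^'n) measure" where
  "density_measure f = density lborel (\<lambda>x. ennreal (f x))"

end

theory Submission
  imports Defs
begin

text \<open>Lattice points in a long cylinder \<open>{|x| \<le> s} \<times> ball\<close> number of order \<open>s^m\<close>, while those near its
  bounding shell number only \<open>o(s^m)\<close>.  Hence, summing a function of the internal coordinate over
  the layer \<open>|x| \<le> s\<close> is, up to \<open>o(s^m)\<close>, invariant under translations by the dense set of star
  images, and so proportional to the Lebesgue integral.  This gives equidistribution of the star
  images of \<open>T_s\<close> in \<open>\<Omega>_Q\<close>, that is \<open>g_s(k) \<rightarrow> g(k)\<close>, the normalised transform of \<open>1_\<Omega>_Q\<close>.

  The invariance equations read \<open>F_s(k) = g_s(k) F_s(A\<^sup>t k)\<close> and \<open>F(k) = g(k) F(A\<^sup>t k)\<close> for the Fourier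
  transforms of the Hutchinson measures and of the density.  Since the powers of \<open>A\<^sup>t\<close> contract
  geometrically and all transforms are Lipschitz at \<open>0\<close> with one constant, iterating gives the product
  formula and, comparing finitely many factors, pointwise convergence; equi-Lipschitz continuity makes it
  locally uniform.  Weak convergence follows since trigonometric polynomials are dense on the
  compact set \<open>\<Omega>\<close>.\<close>

section \<open>Lattices\<close>

text \<open>No constant is ever evaluated. The density of the lattice stays unknown: layer sums are
  compared with that of one fixed bump function, for which the covering radius of the lattice
  supplies a lower bound of order \<open>s^m\<close>, and the normalisation cancels in
  \<open>g_s\<close>, a quotient of two layer sums. Likewise the factor by which \<open>A\<close>
  scales Lebesgue measure stays unknown; it is eliminated by evaluating at \<open>k = 0\<close>,
  where the Fourier transform of a probability measure is 1. Passing from translations by star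
  images to all translations needs uniform continuity, whereas the indicator of
  \<open>Omega_Q\<close> is discontinuous. It is therefore squeezed between continuous functions,
  and here the null boundary enters. Comparing finitely many factors is legitimate because
  \<open>|g_s| \<le> 1\<close>: cutting after \<open>M\<close> factors costs at most
  \<open>L |(A^t)^M k|\<close> for all \<open>s\<close> at once. One \<open>L\<close> suffices since
  the measures and the star images of \<open>T_s\<close> live in the fixed compact sets
  \<open>\<Omega>\<close> and \<open>Omega_Q\<close>.\<close>

lemma lattice_diff:
  assumes "is_lattice \<Gamma>" "x \<in> \<Gamma>" "y \<in> \<Gamma>"
  shows "x - y \<in> \<Gamma>"
proof -
  obtain B where B: "\<Gamma> = range (\<lambda>c :: 'a \<Rightarrow> int. \<Sum>b\<in>B. of_int (c b) *\<^sub>R b)"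
    using assms(1) unfolding is_lattice_def by blast
  obtain c d :: "'a \<Rightarrow> int" where "x = (\<Sum>b\<in>B. of_int (c b) *\<^sub>R b)" "y = (\<Sum>b\<in>B. of_int (d b) *\<^sub>R b)"
    using assms(2,3) unfolding B by blast
  then have "x - y = (\<Sum>b\<in>B. of_int (c b - d b) *\<^sub>R b)"
    by (simp add: sum_subtractf scaleR_diff_left)
  then show ?thesis unfolding B image_iff by (intro bexI[of _ "\<lambda>b. c b - d b"]) auto
qed

lemma lattice_zero:
  assumes "is_lattice \<Gamma>"
  shows "0 \<in> \<Gamma>"
proof -
  obtain x where "x \<in> \<Gamma>"
    using assms unfolding is_lattice_def by blast
  then show ?thesis
    using lattice_diff[OF assms, of x x] by simp
qed

lemma lattice_add:
  assumes "is_lattice \<Gamma>" "x \<in> \<Gamma>" "y \<in> \<Gamma>"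
  shows "x + y \<in> \<Gamma>"
  using lattice_diff[OF assms(1,2) lattice_diff[OF assms(1) lattice_zero[OF assms(1)] assms(3)]]
  by simp

text \<open>A nonzero lattice vector has integer coordinates in the basis, one of them of absolute
  value at least 1, while every coordinate functional is bounded by \<open>M\<close> times the norm.
  The factor 2 makes the balls of radius \<open>r\<close> about lattice points disjoint.\<close>

lemma lattice_separated:
  fixes \<Gamma> :: "'a::euclidean_space set"
  assumes "is_lattice \<Gamma>"
  obtains r where "r > 0" "\<And>x y. x \<in> \<Gamma> \<Longrightarrow> y \<in> \<Gamma> \<Longrightarrow> x \<noteq> y \<Longrightarrow> 2 * r \<le> dist x y"
proof -
  obtain B :: "'a set" where indep: "independent B" and span: "span B = UNIV"
    and B: "\<Gamma> = range (\<lambda>c :: 'a \<Rightarrow> int. \<Sum>b\<in>B. of_int (c b) *\<^sub>R b)"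
    using assms unfolding is_lattice_def by blast
  have fin: "finite B"
    using indep by (rule finiteI_independent)
  define f where "f x = (\<Sum>b\<in>B. \<bar>representation B x b\<bar>)" for x
  have lin: "linear (\<lambda>x. representation B x b)" for b
    by (rule linearI) (auto simp: representation_add representation_scale indep span)
  have "\<exists>K>0. \<forall>x. \<bar>representation B x b\<bar> \<le> K * norm x" for b
    using linear_bounded_pos[OF lin[of b]] by auto
  then obtain K where K: "\<And>b. K b > 0" "\<And>b x. \<bar>representation B x b\<bar> \<le> K b * norm x"
    by metis
  define M where "M = 1 + (\<Sum>b\<in>B. K b)"
  have M: "M > 0" "\<And>b. b \<in> B \<Longrightarrow> K b \<le> M"
  proof -
    show "M > 0"
      unfolding M_def using K(1) by (intro add_pos_nonneg sum_nonneg) (auto intro: less_imp_le)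
    show "K b \<le> M" if "b \<in> B" for b
      unfolding M_def using member_le_sum[OF that, of K] K(1) fin
      by (force intro: less_imp_le)
  qed
  show ?thesis
  proof
    show "1 / (2 * M) > 0" using M(1) by simp
    fix x y assume xy: "x \<in> \<Gamma>" "y \<in> \<Gamma>" "x \<noteq> y"
    then have "x - y \<in> \<Gamma>"
      using lattice_diff assms by blast
    then obtain c :: "'a \<Rightarrow> int" where c: "x - y = (\<Sum>b\<in>B. of_int (c b) *\<^sub>R b)"
      unfolding B by blast
    then obtain b where b: "b \<in> B" "c b \<noteq> 0"
      using xy(3) by (metis (no_types, lifting) eq_iff_diff_eq_0 of_int_0 scale_zero_left sum.neutral)
    have "representation B (x - y) b = of_int (c b)"
      unfolding c using indep span fin b(1)
      by (simp add: representation_sum representation_scale representation_basis span_base if_distrib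
           sum.delta cong: if_cong)
    moreover have "1 \<le> \<bar>real_of_int (c b)\<bar>"
      using b(2) by linarith
    ultimately have "1 \<le> K b * norm (x - y)"
      using K(2)[where x="x - y" and b=b] by simp
    also have "\<dots> \<le> M * norm (x - y)"
      using M(2)[OF b(1)] by (intro mult_right_mono) auto
    finally show "2 * (1 / (2 * M)) \<le> dist x y"
      using M(1) by (simp add: dist_norm field_simps)
  qed
qed

text \<open>Rounding every coordinate down moves a point by at most the sum of the norms of the
  basis vectors.\<close>

lemma lattice_covering:
  fixes \<Gamma> :: "'a::euclidean_space set"
  assumes "is_lattice \<Gamma>"
  obtains R where "R > 0" "\<And>x. \<exists>y\<in>\<Gamma>. dist x y \<le> R"
proof -
  obtain B :: "'a set" where indep: "independent B" and span: "span B = UNIV"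
    and B: "\<Gamma> = range (\<lambda>c :: 'a \<Rightarrow> int. \<Sum>b\<in>B. of_int (c b) *\<^sub>R b)"
    using assms unfolding is_lattice_def by blast
  have fin: "finite B"
    using indep by (rule finiteI_independent)
  show ?thesis
  proof
    show "1 + (\<Sum>b\<in>B. norm b) > 0"
      by (intro add_pos_nonneg sum_nonneg) auto
    fix x
    define c where "c b = \<lfloor>representation B x b\<rfloor>" for b
    have "x - (\<Sum>b\<in>B. of_int (c b) *\<^sub>R b) = (\<Sum>b\<in>B. (representation B x b - of_int (c b)) *\<^sub>R b)"
      using sum_representation_eq[OF indep _ fin order_refl, of x] span
      by (simp add: scaleR_diff_left sum_subtractf)
    also have "norm \<dots> \<le> (\<Sum>b\<in>B. norm b)"
    proof (rule sum_norm_le)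
      fix b
      have "\<bar>representation B x b - of_int (c b)\<bar> \<le> 1"
        unfolding c_def by linarith
      then show "norm ((representation B x b - of_int (c b)) *\<^sub>R b) \<le> norm b"
        by (simp add: mult_left_le_one_le)
    qed
    finally show "\<exists>y\<in>\<Gamma>. dist x y \<le> 1 + (\<Sum>b\<in>B. norm b)"
      unfolding B by (intro bexI[of _ "\<Sum>b\<in>B. of_int (c b) *\<^sub>R b"]) (auto simp: dist_norm)
  qed
qed

section \<open>Counting lattice points\<close>

text \<open>Volume comparison: the balls of radius \<open>r\<close> about the points are disjoint
  and lie in \<open>U\<close>. The bound is proved first for finite subsets; their cardinalities are
  thereby bounded, which yields the finiteness of \<open>X\<close> itself.\<close>

lemma card_packing:
  fixes X U :: "'a::euclidean_space set"
  assumes "r > 0"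
    and sep: "\<And>x y. x \<in> X \<Longrightarrow> y \<in> X \<Longrightarrow> x \<noteq> y \<Longrightarrow> 2 * r \<le> dist x y"
    and U: "U \<in> fmeasurable lborel" and sub: "\<And>x. x \<in> X \<Longrightarrow> ball x r \<subseteq> U"
  shows "finite X" "real (card X) * measure lborel (ball (0::'a) r) \<le> measure lborel U"
proof -
  have pos: "measure lborel (ball (0::'a) r) > 0"
    using assms(1) by simp
  have bound: "real (card Y) * measure lborel (ball (0::'a) r) \<le> measure lborel U"
    if Y: "Y \<subseteq> X" "finite Y" for Y
  proof -
    have "disjoint_family_on (\<lambda>x. ball x r) Y"
      unfolding disjoint_family_on_def
    proof (intro ballI impI equals0I)
      fix x y z assume *: "x \<in> Y" "y \<in> Y" "x \<noteq> y" "z \<in> ball x r \<inter> ball y r"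
      then have "dist x y < 2 * r"
        using dist_triangle[of x y z] by (auto simp: dist_commute)
      then show False using * sep Y(1) by force
    qed
    then have "measure lborel (\<Union>x\<in>Y. ball x r) = (\<Sum>x\<in>Y. measure lborel (ball x r))"
      using Y(2) emeasure_bounded_finite[OF bounded_ball]
      by (intro measure_finite_Union) (auto simp: less_top)
    also have "\<dots> = real (card Y) * measure lborel (ball (0::'a) r)"
      using assms(1) by (simp add: content_ball)
    finally have "real (card Y) * measure lborel (ball (0::'a) r) = measure lborel (\<Union>x\<in>Y. ball x r)" ..
    also have "\<dots> \<le> measure lborel U"
      using Y sub U by (intro measure_mono_fmeasurable) auto
    finally show ?thesis .
  qed
  show fin: "finite X"
  proof -
    obtain N :: nat where "measure lborel U / measure lborel (ball (0::'a) r) \<le> real N"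
      using real_arch_simple by blast
    moreover have "real (card Y) \<le> measure lborel U / measure lborel (ball (0::'a) r)"
      if "Y \<subseteq> X" "finite Y" for Y
      using bound[OF that] pos by (simp only: pos_le_divide_eq)
    ultimately have "card Y \<le> N" if "Y \<subseteq> X" "finite Y" for Y
      using that by (meson of_nat_le_iff order_trans)
    then show ?thesis
      using finite_if_finite_subsets_card_bdd by blast
  qed
  show "real (card X) * measure lborel (ball (0::'a) r) \<le> measure lborel U"
    using bound fin by blast
qed

lemma card_covering:
  fixes X U :: "'a::euclidean_space set"
  assumes "finite X" "U \<in> sets lborel" "U \<subseteq> (\<Union>x\<in>X. cball x R)" "R \<ge> 0"
  shows "measure lborel U \<le> real (card X) * measure lborel (cball (0::'a) R)"
proof -
  have "measure lborel U \<le> measure lborel (\<Union>x\<in>X. cball x R)"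
    using assms(1-3)
    by (intro measure_mono_fmeasurable fmeasurable.finite_UN)
       (auto intro!: fmeasurableI emeasure_bounded_finite)
  also have "\<dots> \<le> (\<Sum>x\<in>X. measure lborel (cball x R))"
    using assms(1) by (intro measure_UNION_le) auto
  also have "\<dots> = real (card X) * measure lborel (cball (0::'a) R)"
    using assms(4) by (simp add: content_cball)
  finally show ?thesis .
qed

lemma measure_lborel_Times:
  fixes S :: "'a::euclidean_space set" and T :: "'b::euclidean_space set"
  assumes "S \<in> sets borel" "T \<in> sets borel"
  shows "measure lborel (S \<times> T) = measure lborel S * measure lborel T"
  unfolding lborel_prod[symmetric] measure_def
  using assms by (simp add: lborel.emeasure_pair_measure_Times enn2real_mult)

lemma fst_snd_ball:
  assumes "z \<in> ball x r"
  shows "norm (fst z) < norm (fst x) + r" "norm (fst x) < norm (fst z) + r"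
    "norm (snd z) < norm (snd x) + r"
  using assms dist_fst_le[of x z] dist_snd_le[of x z]
    norm_triangle_ineq2[of "fst x" "fst z"] norm_triangle_ineq3[of "fst x" "fst z"] norm_triangle_ineq3[of "snd x" "snd z"]
  by (auto simp: dist_norm)

definition cylinder :: "('a::euclidean_space \<times> 'b::euclidean_space) set \<Rightarrow> real \<Rightarrow> real \<Rightarrow> ('a \<times> 'b) set"
  where "cylinder \<Gamma> s B = {\<gamma> \<in> \<Gamma>. norm (fst \<gamma>) \<le> s \<and> norm (snd \<gamma>) \<le> B}"

text \<open>Translation by a vector with physical part of norm \<open>a\<close> can change
  membership in the layer \<open>|x| \<le> s\<close> only for these points. The bound on the
  internal coordinate keeps the set finite.\<close>

definition shell :: "('a::euclidean_space \<times> 'b::euclidean_space) set \<Rightarrow> real \<Rightarrow> real \<Rightarrow> real \<Rightarrow> ('a \<times> 'b) set"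
  where "shell \<Gamma> a s B = {\<gamma> \<in> \<Gamma>. s - a \<le> norm (fst \<gamma>) \<and> norm (fst \<gamma>) \<le> s + a \<and> norm (snd \<gamma>) \<le> B}"

locale product_lattice =
  fixes \<Gamma> :: "('a::euclidean_space \<times> 'b::euclidean_space) set"
  assumes lattice: "is_lattice \<Gamma>"
begin

lemma finite_cylinder: "finite (cylinder \<Gamma> s B)"
proof -
  obtain r where r: "r > 0" "\<And>x y. x \<in> \<Gamma> \<Longrightarrow> y \<in> \<Gamma> \<Longrightarrow> x \<noteq> y \<Longrightarrow> 2 * r \<le> dist x y"
    using lattice_separated[OF lattice] by blast
  have "ball x r \<subseteq> cball 0 (s + r) \<times> cball 0 (B + r)" if "x \<in> cylinder \<Gamma> s B" for x
  proof
    fix z assume "z \<in> ball x r"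
    then show "z \<in> cball 0 (s + r) \<times> cball 0 (B + r)"
      using that fst_snd_ball[of z x r] by (cases z) (auto simp: cylinder_def)
  qed
  moreover have "cball 0 (s + r) \<times> cball 0 (B + r) \<in> fmeasurable (lborel :: ('a \<times> 'b) measure)"
    by (intro fmeasurable_compact compact_Times compact_cball)
  ultimately show ?thesis
    by (intro card_packing(1)[OF r(1), of _ "cball 0 (s + r) \<times> cball 0 (B + r)"])
       (auto simp: cylinder_def intro!: r(2))
qed

lemma finite_shell: "finite (shell \<Gamma> a s B)"
proof (rule finite_subset)
  show "shell \<Gamma> a s B \<subseteq> cylinder \<Gamma> (s + a) B"
    by (auto simp: shell_def cylinder_def)
qed (rule finite_cylinder)

text \<open>The disjoint balls of radius \<open>r\<close> about the points lie in a spherical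
  annulus of half-width \<open>a + r\<close> times an internal ball; its volume carries the
  difference of the two powers.\<close>

lemma card_shell_le:
  obtains K r where "r > 0"
    "\<And>s. s \<ge> a + r \<Longrightarrow> real (card (shell \<Gamma> a s B)) \<le> K * ((s + (a + r)) ^ DIM('a) - (s - (a + r)) ^ DIM('a))"
proof -
  obtain r where r: "r > 0" "\<And>x y. x \<in> \<Gamma> \<Longrightarrow> y \<in> \<Gamma> \<Longrightarrow> x \<noteq> y \<Longrightarrow> 2 * r \<le> dist x y"
    using lattice_separated[OF lattice] by blast
  define v where "v = measure lborel (ball (0::'a \<times> 'b) r)"
  have v: "v > 0" unfolding v_def using r(1) by simp
  show ?thesis
  proof (cases "a < 0 \<or> B < 0")
    \<comment> \<open>The volume formulas of the other case need non-negative radii; here the shell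
      is empty.\<close>
    case True
    have "False" if "\<gamma> \<in> shell \<Gamma> a s B" for \<gamma> s
      using that True norm_ge_zero[of "snd \<gamma>"] unfolding shell_def mem_Collect_eq by linarith
    then have "shell \<Gamma> a s B = {}" for s
      by blast
    then show ?thesis using that[OF r(1), of 0] by simp
  next
    case False
    define K where "K = unit_ball_vol (real DIM('a)) * measure lborel (cball (0::'b) (B + r)) / v"
    show ?thesis
    proof (rule that[OF r(1), of K])
      fix s assume s: "s \<ge> a + r"
      define U where "U = (cball (0::'a) (s + a + r) - ball 0 (s - a - r)) \<times> cball (0::'b) (B + r)"
      have U0: "measure lborel U = unit_ball_vol (real DIM('a)) * ((s + (a + r)) ^ DIM('a) - (s - (a + r)) ^ DIM('a))
          * measure lborel (cball (0::'b) (B + r))"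
      proof -
        have "measure lborel (cball (0::'a) (s + a + r) - ball 0 (s - a - r)) =
           measure lborel (cball (0::'a) (s + a + r)) - measure lborel (ball (0::'a) (s - a - r))"
          using s r(1) False by (intro measurable_measure_Diff fmeasurable_compact compact_cball) auto
        also have "\<dots> = unit_ball_vol (real DIM('a)) * ((s + (a + r)) ^ DIM('a) - (s - (a + r)) ^ DIM('a))"
          using s r(1) False
          by (simp add: content_ball content_cball add.assoc diff_diff_eq right_diff_distrib)
        finally show ?thesis
          unfolding U_def by (subst measure_lborel_Times) auto
      qed
      have "U \<in> fmeasurable lborel"
        unfolding U_def
        by (intro fmeasurable_compact compact_Times compact_cball compact_diff open_ball)
      moreover have "ball x r \<subseteq> U" if "x \<in> shell \<Gamma> a s B" for x
      proof
        fix z assume "z \<in> ball x r"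
        then show "z \<in> U"
          using that fst_snd_ball[of z x r] unfolding U_def by (cases z) (auto simp: shell_def)
      qed
      ultimately have "real (card (shell \<Gamma> a s B)) * v \<le> measure lborel U"
        unfolding v_def by (intro card_packing(2)[OF r(1)]) (auto simp: shell_def intro!: r(2))
      then show "real (card (shell \<Gamma> a s B)) \<le> K * ((s + (a + r)) ^ DIM('a) - (s - (a + r)) ^ DIM('a))"
        using v unfolding U0 K_def by (simp add: field_simps)
    qed
  qed
qed

text \<open>Divided by the power of \<open>s\<close>, the bound becomes
  \<open>K * ((1 + c / s) ^ m - (1 - c / s) ^ m)\<close>, in which the leading terms cancel.\<close>

lemma card_shell_asymp:
  "((\<lambda>s. real (card (shell \<Gamma> a s B)) / s ^ DIM('a)) \<longlongrightarrow> 0) at_top"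
proof -
  obtain r K where r: "r > 0" and K:
    "\<And>s. s \<ge> a + r \<Longrightarrow> real (card (shell \<Gamma> a s B)) \<le> K * ((s + (a + r)) ^ DIM('a) - (s - (a + r)) ^ DIM('a))"
    using card_shell_le by blast
  define c where "c = a + r"
  have c0: "((\<lambda>s. c / s) \<longlongrightarrow> 0) at_top"
    by (rule tendsto_divide_0[OF tendsto_const filterlim_at_top_imp_at_infinity[OF filterlim_ident]])
  have lim: "((\<lambda>s. K * ((1 + c / s) ^ DIM('a) - (1 - c / s) ^ DIM('a))) \<longlongrightarrow> K * ((1 + 0) ^ DIM('a) - (1 - 0) ^ DIM('a))) at_top"
    by (intro tendsto_intros c0)
  show ?thesis
  proof (rule tendsto_sandwich[OF _ _ tendsto_const])
    show "\<forall>\<^sub>F s in at_top. 0 \<le> real (card (shell \<Gamma> a s B)) / s ^ DIM('a)"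
      using eventually_gt_at_top[of 0] by eventually_elim simp
    show "\<forall>\<^sub>F s in at_top. real (card (shell \<Gamma> a s B)) / s ^ DIM('a) \<le> K * ((1 + c / s) ^ DIM('a) - (1 - c / s) ^ DIM('a))"
      using eventually_gt_at_top[of 0] eventually_ge_at_top[of c]
    proof eventually_elim
      case (elim s)
      have "1 + c / s = (s + c) / s" "1 - c / s = (s - c) / s"
        using elim by (simp_all add: add_divide_distrib diff_divide_distrib)
      then have "K * ((1 + c / s) ^ DIM('a) - (1 - c / s) ^ DIM('a)) = K * ((s + c) ^ DIM('a) - (s - c) ^ DIM('a)) / s ^ DIM('a)"
        by (simp only: power_divide diff_divide_distrib[symmetric] times_divide_eq_right)
      moreover have "real (card (shell \<Gamma> a s B)) \<le> K * ((s + c) ^ DIM('a) - (s - c) ^ DIM('a))"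
        using K[of s] elim unfolding c_def[symmetric] by simp
      ultimately show ?case
        using elim by (simp only: divide_right_mono zero_le_power less_imp_le)
    qed
    show "((\<lambda>s. K * ((1 + c / s) ^ DIM('a) - (1 - c / s) ^ DIM('a))) \<longlongrightarrow> 0) at_top"
      using lim by simp
  qed
qed

lemma card_cylinder_le:
  obtains K where "K \<ge> 0" "\<forall>\<^sub>F s in at_top. real (card (cylinder \<Gamma> s B)) \<le> K * s ^ DIM('a)"
proof -
  obtain r where r: "r > 0" "\<And>x y. x \<in> \<Gamma> \<Longrightarrow> y \<in> \<Gamma> \<Longrightarrow> x \<noteq> y \<Longrightarrow> 2 * r \<le> dist x y"
    using lattice_separated[OF lattice] by blast
  define v where "v = measure lborel (ball (0::'a \<times> 'b) r)"
  have v: "v > 0" unfolding v_def using r(1) by simp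
  define K where "K = unit_ball_vol (real DIM('a)) * 2 ^ DIM('a) * measure lborel (cball (0::'b) (B + r)) / v"
  have bound: "real (card (cylinder \<Gamma> s B)) \<le> K * s ^ DIM('a)" if "s \<ge> r" for s
  proof -
    \<comment> \<open>The balls about cylinder points reach out to physical radius
      \<open>s + r\<close>, which is at most \<open>2 * s\<close> for \<open>s \<ge> r\<close>; the
      volume is then an exact multiple of the power of \<open>s\<close>.\<close>
    define U where "U = cball (0::'a) (2 * s) \<times> cball (0::'b) (B + r)"
    have "U \<in> fmeasurable lborel"
      unfolding U_def by (intro fmeasurable_compact compact_Times compact_cball)
    moreover have "ball x r \<subseteq> U" if "x \<in> cylinder \<Gamma> s B" for x
    proof
      fix z assume "z \<in> ball x r"
      then show "z \<in> U"
        using that fst_snd_ball[of z x r] \<open>s \<ge> r\<close> unfolding U_def by (cases z) (auto simp: cylinder_def)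
    qed
    ultimately have "real (card (cylinder \<Gamma> s B)) * v \<le> measure lborel U"
      unfolding v_def by (intro card_packing(2)[OF r(1)]) (auto simp: cylinder_def intro!: r(2))
    also have "measure lborel U = unit_ball_vol (real DIM('a)) * (2 * s) ^ DIM('a) * measure lborel (cball (0::'b) (B + r))"
      using that r(1) unfolding U_def by (subst measure_lborel_Times) (auto simp: content_cball)
    finally show ?thesis
      using v unfolding K_def by (simp add: power_mult_distrib pos_le_divide_eq mult_ac)
  qed
  show ?thesis
  proof
    show "K \<ge> 0" unfolding K_def using v by simp
    show "\<forall>\<^sub>F s in at_top. real (card (cylinder \<Gamma> s B)) \<le> K * s ^ DIM('a)"
      using eventually_ge_at_top[of r] by eventually_elim (rule bound)
  qed
qed

text \<open>Each point of the smaller cylinder with radii \<open>s / 2\<close> and 1 lies within the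
  covering radius \<open>R\<close> of a lattice point. For \<open>R \<le> s / 2\<close> that lattice
  point belongs to the cylinder with radii \<open>s\<close> and \<open>1 + R\<close>, so the volume
  of the small cylinder bounds the count from below.\<close>

lemma card_cylinder_ge:
  obtains c B where "c > 0" "B > 0" "\<forall>\<^sub>F s in at_top. c * s ^ DIM('a) \<le> real (card (cylinder \<Gamma> s B))"
proof -
  obtain R where R: "R > 0" "\<And>x. \<exists>y\<in>\<Gamma>. dist x y \<le> R"
    using lattice_covering[OF lattice] by blast
  define v where "v = measure lborel (cball (0::'a \<times> 'b) R)"
  have v: "v > 0" unfolding v_def using R(1) by simp
  define c where "c = unit_ball_vol (real DIM('a)) * (1/2) ^ DIM('a) * measure lborel (cball (0::'b) 1) / v"
  have bound: "c * s ^ DIM('a) \<le> real (card (cylinder \<Gamma> s (1 + R)))" if s: "s \<ge> 2 * R" for s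
  proof -
    define U where "U = cball (0::'a) (s / 2) \<times> cball (0::'b) 1"
    have "U \<subseteq> (\<Union>x\<in>cylinder \<Gamma> s (1 + R). cball x R)"
    proof
      fix z assume z: "z \<in> U"
      obtain y where y: "y \<in> \<Gamma>" "dist z y \<le> R" using R(2) by blast
      then have "norm (fst y) \<le> norm (fst z) + R" "norm (snd y) \<le> norm (snd z) + R"
        using dist_fst_le[of y z] dist_snd_le[of y z]
          norm_triangle_ineq2[of "fst y" "fst z"] norm_triangle_ineq2[of "snd y" "snd z"]
        by (auto simp: dist_norm norm_minus_commute)
      with y z s have "y \<in> cylinder \<Gamma> s (1 + R)"
        unfolding U_def by (auto simp: cylinder_def)
      then show "z \<in> (\<Union>x\<in>cylinder \<Gamma> s (1 + R). cball x R)"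
        using y(2) by (auto simp: dist_commute)
    qed
    moreover have "U \<in> sets lborel"
      unfolding U_def by (simp add: borel_closed closed_Times)
    ultimately have "measure lborel U \<le> real (card (cylinder \<Gamma> s (1 + R))) * v"
      unfolding v_def using R(1) by (intro card_covering finite_cylinder) auto
    moreover have "measure lborel U = unit_ball_vol (real DIM('a)) * (s / 2) ^ DIM('a) * measure lborel (cball (0::'b) 1)"
      using that R(1) unfolding U_def by (subst measure_lborel_Times) (auto simp: content_cball)
    ultimately show ?thesis
      using v unfolding c_def by (simp add: power_divide pos_divide_le_eq mult_ac)
  qed
  show ?thesis
  proof
    show "c > 0" unfolding c_def using v
      by (simp add: content_cball_gt_0_iff)
    show "1 + R > 0" using R(1) by simp
    show "\<forall>\<^sub>F s in at_top. c * s ^ DIM('a) \<le> real (card (cylinder \<Gamma> s (1 + R)))"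
      using eventually_ge_at_top[of "2 * R"] by eventually_elim (rule bound)
  qed
qed

end

section \<open>Continuous functions vanishing outside a ball\<close>

lemma integrable_vanishing:
  fixes h :: "'a::euclidean_space \<Rightarrow> 'b::{banach, second_countable_topology}"
  assumes "continuous_on UNIV h" and "\<And>x. norm x > B \<Longrightarrow> h x = 0"
  shows "integrable lborel h"
proof -
  have "integrable lborel (\<lambda>x. indicator (cball 0 B) x *\<^sub>R h x)"
    using assms(1) by (intro borel_integrable_compact compact_cball) (auto intro: continuous_on_subset)
  also have "(\<lambda>x. indicator (cball 0 B) x *\<^sub>R h x) = h"
    using assms(2) by (auto simp: fun_eq_iff indicator_def not_le)
  finally show ?thesis .
qed

lemma bounded_vanishing:
  fixes h :: "'a::euclidean_space \<Rightarrow> 'b::real_normed_vector"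
  assumes "continuous_on UNIV h" and "\<And>x. norm x > B \<Longrightarrow> h x = 0"
  obtains M where "M > 0" "\<And>x. norm (h x) \<le> M"
proof -
  have "compact (h ` cball 0 B)"
    using assms(1) by (intro compact_continuous_image) (auto intro: continuous_on_subset)
  then obtain M where M: "M > 0" "\<forall>y\<in>h ` cball 0 B. norm y \<le> M"
    using compact_imp_bounded bounded_pos by blast
  have "norm (h x) \<le> M" for x
    using M assms(2)[of x] by (cases "norm x \<le> B") auto
  then show ?thesis using that M(1) by blast
qed

lemma lborel_integral_reflect:
  fixes F :: "'a::euclidean_space \<Rightarrow> 'b::{banach, second_countable_topology}"
  assumes "F \<in> borel_measurable borel"
  shows "(LINT y|lborel. F (x - y)) = (LINT y|lborel. F y)"
proof -
  have "(lborel :: 'a measure) = distr lborel borel (\<lambda>y. x - y)"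
    using lborel_affine[of "-1" x] by (simp add: density_1)
  then have "(LINT y|lborel. F y) = (LINT y|distr lborel borel (\<lambda>y. x - y). F y)"
    by metis
  also have "\<dots> = (LINT y|lborel. F (x - y))"
    using assms by (intro integral_distr) auto
  finally show ?thesis ..
qed

lemma lborel_integral_translate:
  fixes F :: "'a::euclidean_space \<Rightarrow> 'b::{banach, second_countable_topology}"
  assumes "F \<in> borel_measurable borel"
  shows "(LINT y|lborel. F (y + x)) = (LINT y|lborel. F y)"
proof -
  have "(LINT y|lborel. F y) = (LINT y|distr lborel borel ((+) x). F y)"
    by (simp only: lborel_distr_plus)
  also have "\<dots> = (LINT y|lborel. F (x + y))"
    using assms by (intro integral_distr) auto
  finally show ?thesis by (simp add: add.commute)
qed

lemma convolution_commute:
  fixes h g :: "'a::euclidean_space \<Rightarrow> 'b::{banach, second_countable_topology, real_normed_field}"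
  assumes "continuous_on UNIV h" "continuous_on UNIV g"
  shows "(LINT y|lborel. h (x - y) * g y) = (LINT y|lborel. g (x - y) * h y)"
proof -
  have "(\<lambda>y. g (x - y) * h y) \<in> borel_measurable borel"
    by (intro borel_measurable_continuous_onI continuous_intros continuous_on_compose2[OF assms(2)] assms) auto
  from lborel_integral_reflect[OF this, of x] show ?thesis
    by (simp add: mult.commute)
qed

lemma Fubini_continuous:
  fixes F :: "'a::euclidean_space \<Rightarrow> 'b::euclidean_space \<Rightarrow> 'c::{banach, second_countable_topology}"
  assumes "continuous_on UNIV (\<lambda>(x, y). F x y)"
    and "\<And>x y. norm x > B \<or> norm y > B \<Longrightarrow> F x y = 0"
  shows "(LINT x|lborel. LINT y|lborel. F x y) = (LINT y|lborel. LINT x|lborel. F x y)"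
proof -
  have "integrable lborel (\<lambda>(x, y). F x y)"
  proof (rule integrable_vanishing[OF assms(1), of "\<bar>B\<bar> + \<bar>B\<bar>"])
    fix z :: "'a \<times> 'b" assume "norm z > \<bar>B\<bar> + \<bar>B\<bar>"
    then show "(case z of (x, y) \<Rightarrow> F x y) = 0"
      using norm_Pair_le[of "fst z" "snd z"] assms(2)[of "fst z" "snd z"]
      by (cases z) fastforce
  qed
  then show ?thesis
    by (intro lborel_pair.Fubini_integral[symmetric]) (simp add: lborel_prod)
qed

text \<open>Variant for integrands that are not continuous themselves but arise from a continuous
  function by cutting off with indicators of compact sets, as happens with the indicator of
  \<open>Omega_Q\<close>.\<close>

lemma Fubini_compact:
  fixes F :: "'a::euclidean_space \<Rightarrow> 'b::euclidean_space \<Rightarrow> 'c::{banach, second_countable_topology}"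
  assumes "continuous_on UNIV (\<lambda>(x, y). F x y)" "compact S" "compact T"
  shows "(LINT x|lborel. LINT y|lborel. indicator S x *\<^sub>R indicator T y *\<^sub>R F x y)
     = (LINT y|lborel. LINT x|lborel. indicator S x *\<^sub>R indicator T y *\<^sub>R F x y)"
proof -
  have "integrable lborel (\<lambda>z. indicator (S \<times> T) z *\<^sub>R (case z of (x, y) \<Rightarrow> F x y))"
    using assms by (intro borel_integrable_compact compact_Times) (auto intro: continuous_on_subset)
  also have "(\<lambda>z. indicator (S \<times> T) z *\<^sub>R (case z of (x, y) \<Rightarrow> F x y)) = (\<lambda>(x, y). indicator S x *\<^sub>R indicator T y *\<^sub>R F x y)"
    by (auto simp: fun_eq_iff indicator_def)
  finally show ?thesis
    by (intro lborel_pair.Fubini_integral[symmetric]) (simp add: lborel_prod)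
qed

section \<open>Equidistribution of star images\<close>

lemma sum_diff_le:
  fixes f :: "'a \<Rightarrow> real"
  assumes "finite X" "finite Y" "finite Z" "X - Y \<subseteq> Z" "Y - X \<subseteq> Z" and "\<And>x. \<bar>f x\<bar> \<le> M"
  shows "\<bar>sum f X - sum f Y\<bar> \<le> M * real (card Z)"
proof -
  have "sum f X - sum f Y = sum f (X - Y) - sum f (Y - X)"
    using sum.Int_Diff[OF assms(1), of f Y] sum.Int_Diff[OF assms(2), of f X] by (simp add: Int_commute)
  also have "\<bar>\<dots>\<bar> \<le> (\<Sum>x\<in>X - Y. \<bar>f x\<bar>) + (\<Sum>x\<in>Y - X. \<bar>f x\<bar>)"
    using sum_abs[of f "X - Y"] sum_abs[of f "Y - X"] by linarith
  also have "\<dots> = (\<Sum>x\<in>(X - Y) \<union> (Y - X). \<bar>f x\<bar>)"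
    using assms by (intro sum.union_disjoint[symmetric]) auto
  also have "\<dots> \<le> (\<Sum>x\<in>Z. \<bar>f x\<bar>)"
    using assms by (intro sum_mono2) auto
  also have "\<dots> \<le> M * real (card Z)"
    using sum_bounded_above[of Z "\<lambda>x. \<bar>f x\<bar>" M] assms(6) by (simp add: mult.commute)
  finally show ?thesis .
qed

text \<open>A layer \<open>|x| \<le> s\<close> is unbounded in the internal direction, and a sum
  over an infinite set is 0 by convention. Restricting to nonzero values leaves a finite index set
  whenever \<open>h\<close> vanishes outside a ball, without naming that ball.\<close>

definition layer_sum :: "('a::euclidean_space \<times> 'b::euclidean_space) set \<Rightarrow> ('b \<Rightarrow> real) \<Rightarrow> real \<Rightarrow> real"
  where "layer_sum \<Gamma> h s = (\<Sum>\<gamma> | \<gamma> \<in> \<Gamma> \<and> norm (fst \<gamma>) \<le> s \<and> h (snd \<gamma>) \<noteq> 0. h (snd \<gamma>))"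

context product_lattice
begin

lemma layer_sum_eq:
  assumes "\<And>x. norm x > B \<Longrightarrow> h x = 0"
  shows "layer_sum \<Gamma> h s = (\<Sum>\<gamma>\<in>cylinder \<Gamma> s B. h (snd \<gamma>))"
  unfolding layer_sum_def
proof (rule sum.mono_neutral_left[OF finite_cylinder])
  show "{\<gamma>. \<gamma> \<in> \<Gamma> \<and> norm (fst \<gamma>) \<le> s \<and> h (snd \<gamma>) \<noteq> 0} \<subseteq> cylinder \<Gamma> s B"
    using assms by (force simp: cylinder_def)
  show "\<forall>i\<in>cylinder \<Gamma> s B - {\<gamma>. \<gamma> \<in> \<Gamma> \<and> norm (fst \<gamma>) \<le> s \<and> h (snd \<gamma>) \<noteq> 0}. h (snd i) = 0"
    by (auto simp: cylinder_def)
qed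

lemma layer_sum_diff_le:
  assumes "\<And>x. norm x > B \<Longrightarrow> h x = 0" "\<And>x. norm x > B \<Longrightarrow> g x = 0" "\<And>x. \<bar>h x - g x\<bar> \<le> e"
  shows "\<bar>layer_sum \<Gamma> h s - layer_sum \<Gamma> g s\<bar> \<le> e * real (card (cylinder \<Gamma> s B))"
proof -
  have "layer_sum \<Gamma> h s - layer_sum \<Gamma> g s = (\<Sum>\<gamma>\<in>cylinder \<Gamma> s B. h (snd \<gamma>) - g (snd \<gamma>))"
    using layer_sum_eq[of B h] layer_sum_eq[of B g] assms by (simp add: sum_subtractf)
  also have "\<bar>\<dots>\<bar> \<le> (\<Sum>\<gamma>\<in>cylinder \<Gamma> s B. \<bar>h (snd \<gamma>) - g (snd \<gamma>)\<bar>)"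
    by (rule sum_abs)
  also have "\<dots> \<le> e * real (card (cylinder \<Gamma> s B))"
    using sum_bounded_above[of "cylinder \<Gamma> s B" "\<lambda>\<gamma>. \<bar>h (snd \<gamma>) - g (snd \<gamma>)\<bar>" e] assms(3)
    by (simp add: mult.commute)
  finally show ?thesis .
qed

text \<open>Substituting \<open>\<gamma> + \<gamma>\<^sub>0\<close> for the summation variable turns
  the translate into a sum of \<open>h\<close> itself over a shifted layer. The two index sets
  differ only in points of the shell of half-width \<open>norm (fst \<gamma>\<^sub>0)\<close>, each
  contributing at most \<open>M\<close>.\<close>

lemma layer_sum_translate_lattice:
  assumes "\<And>x. norm x > B \<Longrightarrow> h x = 0" "\<And>x. \<bar>h x\<bar> \<le> M" "\<gamma>\<^sub>0 \<in> \<Gamma>"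
  shows "\<bar>layer_sum \<Gamma> (\<lambda>x. h (x - snd \<gamma>\<^sub>0)) s - layer_sum \<Gamma> h s\<bar>
    \<le> M * real (card (shell \<Gamma> (norm (fst \<gamma>\<^sub>0)) s B))"
proof -
  define X where "X = {\<gamma>. \<gamma> \<in> \<Gamma> \<and> norm (fst \<gamma> + fst \<gamma>\<^sub>0) \<le> s \<and> h (snd \<gamma>) \<noteq> 0}"
  define Y where "Y = {\<gamma>. \<gamma> \<in> \<Gamma> \<and> norm (fst \<gamma>) \<le> s \<and> h (snd \<gamma>) \<noteq> 0}"
  define a where "a = norm (fst \<gamma>\<^sub>0)"
  have near: "norm (fst \<gamma>) \<le> norm (fst \<gamma> + fst \<gamma>\<^sub>0) + a" "norm (fst \<gamma> + fst \<gamma>\<^sub>0) \<le> norm (fst \<gamma>) + a" for \<gamma> :: "'a \<times> 'b"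
    unfolding a_def using norm_triangle_ineq[of "fst \<gamma>" "fst \<gamma>\<^sub>0"] norm_diff_ineq[of "fst \<gamma>" "fst \<gamma>\<^sub>0"] by auto
  have small: "norm x \<le> B" if "h x \<noteq> 0" for x
    using assms(1)[of x] that by linarith
  have "layer_sum \<Gamma> (\<lambda>x. h (x - snd \<gamma>\<^sub>0)) s = (\<Sum>\<gamma>\<in>X. h (snd \<gamma>))"
    unfolding layer_sum_def X_def
    by (rule sum.reindex_bij_witness[of _ "\<lambda>\<gamma>. \<gamma> + \<gamma>\<^sub>0" "\<lambda>\<gamma>. \<gamma> - \<gamma>\<^sub>0"])
       (auto simp: lattice_diff[OF lattice] lattice_add[OF lattice] assms(3))
  moreover have "layer_sum \<Gamma> h s = (\<Sum>\<gamma>\<in>Y. h (snd \<gamma>))"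
    unfolding layer_sum_def Y_def by simp
  moreover have "\<bar>(\<Sum>\<gamma>\<in>X. h (snd \<gamma>)) - (\<Sum>\<gamma>\<in>Y. h (snd \<gamma>))\<bar> \<le> M * real (card (shell \<Gamma> a s B))"
  proof (rule sum_diff_le[OF _ _ finite_shell])
    have "X \<subseteq> cylinder \<Gamma> (s + a) B"
    proof
      fix \<gamma> assume "\<gamma> \<in> X"
      then show "\<gamma> \<in> cylinder \<Gamma> (s + a) B"
        using near[of \<gamma>] small unfolding X_def cylinder_def by auto
    qed
    then show "finite X" by (rule finite_subset[OF _ finite_cylinder])
    have "Y \<subseteq> cylinder \<Gamma> s B" using small unfolding Y_def cylinder_def by auto
    then show "finite Y" by (rule finite_subset[OF _ finite_cylinder])
    show "X - Y \<subseteq> shell \<Gamma> a s B"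
    proof
      fix \<gamma> assume "\<gamma> \<in> X - Y"
      then show "\<gamma> \<in> shell \<Gamma> a s B"
        using near[of \<gamma>] small[of "snd \<gamma>"] norm_ge_zero[of "fst \<gamma>\<^sub>0"] unfolding X_def Y_def shell_def a_def by auto
    qed
    show "Y - X \<subseteq> shell \<Gamma> a s B"
    proof
      fix \<gamma> assume "\<gamma> \<in> Y - X"
      then show "\<gamma> \<in> shell \<Gamma> a s B"
        using near[of \<gamma>] small[of "snd \<gamma>"] norm_ge_zero[of "fst \<gamma>\<^sub>0"] unfolding X_def Y_def shell_def a_def by auto
    qed
  qed (rule assms(2))
  ultimately show ?thesis unfolding a_def by simp
qed

end

locale cut_and_project_lattice = product_lattice +
  assumes dense: "closure (snd ` \<Gamma>) = UNIV"
begin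

text \<open>Density replaces \<open>y\<close> by a nearby star image
  \<open>snd \<gamma>\<^sub>0\<close>. Uniform continuity makes this cost a small amount at each of
  the \<open>O(s^m)\<close> cylinder points, and the remaining lattice translation costs only a
  shell, which is \<open>o(s^m)\<close>.\<close>

lemma layer_sum_translate:
  assumes cont: "continuous_on UNIV h" and van: "\<And>x. norm x > B \<Longrightarrow> h x = 0"
  shows "((\<lambda>s. (layer_sum \<Gamma> (\<lambda>x. h (x - y)) s - layer_sum \<Gamma> h s) / s ^ DIM('a)) \<longlongrightarrow> 0) at_top"
proof (rule tendstoI)
  fix e :: real assume e: "e > 0"
  obtain M where M: "M > 0" "\<And>x. \<bar>h x\<bar> \<le> M"
    using bounded_vanishing[OF cont van] by auto
  \<comment> \<open>This ball contains the supports of both translates, because the approximating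
    star image will have norm at most \<open>norm y + 1\<close>.\<close>
  define B' where "B' = \<bar>B\<bar> + norm y + 1"
  obtain K where K: "K \<ge> 0" "\<forall>\<^sub>F s in at_top. real (card (cylinder \<Gamma> s B')) \<le> K * s ^ DIM('a)"
    using card_cylinder_le by blast
  \<comment> \<open>Chosen so that \<open>e' * K\<close> is at most \<open>e / 2\<close>; the
    \<open>+ 1\<close> covers \<open>K = 0\<close>.\<close>
  define e' where "e' = e / (2 * (K + 1))"
  have e': "e' > 0" "e' * K < e / 2 \<or> K = 0"
    unfolding e'_def using e K(1) by (auto simp: field_simps)
  have "uniformly_continuous_on (cball 0 (2 * B')) h"
    using cont by (intro compact_uniformly_continuous) (auto intro: continuous_on_subset)
  then obtain d where d: "d > 0" "\<And>x x'. x \<in> cball 0 (2 * B') \<Longrightarrow> x' \<in> cball 0 (2 * B') \<Longrightarrow> dist x' x < d \<Longrightarrow> dist (h x') (h x) < e'"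
    unfolding uniformly_continuous_on_def using e'(1) by metis
  have "y \<in> closure (snd ` \<Gamma>)" using dense by simp
  then obtain \<gamma>\<^sub>0 where \<gamma>\<^sub>0: "\<gamma>\<^sub>0 \<in> \<Gamma>" "dist (snd \<gamma>\<^sub>0) y < min d 1"
    using d(1) unfolding closure_approachable by (metis (no_types, lifting) imageE min_less_iff_conj zero_less_one)
  have ny: "norm (snd \<gamma>\<^sub>0) \<le> norm y + 1"
    using \<gamma>\<^sub>0(2) norm_triangle_ineq2[of "snd \<gamma>\<^sub>0" y] by (simp add: dist_norm)
  define a where "a = norm (fst \<gamma>\<^sub>0)"
  have van1: "h (x - y) = 0" "h (x - snd \<gamma>\<^sub>0) = 0" if "norm x > B'" for x
    using that ny norm_triangle_ineq2[of x y] norm_triangle_ineq2[of x "snd \<gamma>\<^sub>0"]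
    by (auto intro!: van simp: B'_def)
  have "\<bar>h (x - y) - h (x - snd \<gamma>\<^sub>0)\<bar> \<le> e'" for x
  proof (cases "norm x > B'")
    case True then show ?thesis using van1[of x] e'(1) by simp
  next
    case False
    then have "norm (x - y) \<le> 2 * B'" "norm (x - snd \<gamma>\<^sub>0) \<le> 2 * B'"
      using ny norm_triangle_ineq4[of x y] norm_triangle_ineq4[of x "snd \<gamma>\<^sub>0"] by (auto simp: B'_def)
    moreover have "dist (x - y) (x - snd \<gamma>\<^sub>0) < d"
      using \<gamma>\<^sub>0(2) by (simp add: dist_norm)
    ultimately show ?thesis
      using d(2)[of "x - snd \<gamma>\<^sub>0" "x - y"] by (simp add: dist_real_def)
  qed
  then have 1: "\<bar>layer_sum \<Gamma> (\<lambda>x. h (x - y)) s - layer_sum \<Gamma> (\<lambda>x. h (x - snd \<gamma>\<^sub>0)) s\<bar> \<le> e' * real (card (cylinder \<Gamma> s B'))" for s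
    using van1 by (intro layer_sum_diff_le)
  have 2: "\<bar>layer_sum \<Gamma> (\<lambda>x. h (x - snd \<gamma>\<^sub>0)) s - layer_sum \<Gamma> h s\<bar> \<le> M * real (card (shell \<Gamma> a s B))" for s
    unfolding a_def using van M(2) \<gamma>\<^sub>0(1) by (intro layer_sum_translate_lattice)
  have "\<forall>\<^sub>F s in at_top. real (card (shell \<Gamma> a s B)) / s ^ DIM('a) < e / (2 * M)"
    using order_tendstoD(2)[OF card_shell_asymp, of "e / (2 * M)" a B] e M(1) by simp
  then show "\<forall>\<^sub>F s in at_top. dist ((layer_sum \<Gamma> (\<lambda>x. h (x - y)) s - layer_sum \<Gamma> h s) / s ^ DIM('a)) 0 < e"
    using K(2) eventually_gt_at_top[of 0]
  proof eventually_elim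
    case (elim s)
    have "\<bar>layer_sum \<Gamma> (\<lambda>x. h (x - y)) s - layer_sum \<Gamma> h s\<bar> \<le> e' * real (card (cylinder \<Gamma> s B')) + M * real (card (shell \<Gamma> a s B))"
      using 1[of s] 2[of s] by linarith
    also have "\<dots> \<le> e' * (K * s ^ DIM('a)) + M * real (card (shell \<Gamma> a s B))"
      using elim e'(1) M(1) by (intro add_mono mult_left_mono) auto
    also have "\<dots> \<le> (e / 2) * s ^ DIM('a) + M * real (card (shell \<Gamma> a s B))"
    proof -
      have "e' * K \<le> e / 2" using e' e by auto
      then show ?thesis using elim(3) by (simp add: mult.assoc[symmetric] mult_right_mono)
    qed
    also have "\<dots> < e * s ^ DIM('a)"
      using elim M(1) by (simp add: field_simps)
    finally show ?case
      using elim(3) by (simp add: dist_real_def abs_divide pos_divide_less_eq)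
  qed
qed

text \<open>The layer sum of a convolution \<open>h * g\<close> is asymptotically \<open>(\<integral>g)\<close> times the layer sum of \<open>h\<close>;
  as convolution is commutative, layer sums are asymptotically proportional to integrals, exactly as in
  the uniqueness proof for Haar measure.\<close>

lemma layer_sum_convolution:
  assumes h: "continuous_on UNIV h" "\<And>x. norm x > B \<Longrightarrow> h x = 0"
    and g: "continuous_on UNIV g" "\<And>x. norm x > B \<Longrightarrow> g x = 0"
  shows "((\<lambda>s. (layer_sum \<Gamma> (\<lambda>x. LINT y|lborel. h (x - y) * g y) s
      - layer_sum \<Gamma> h s * (LINT y|lborel. g y)) / s ^ DIM('a)) \<longlongrightarrow> 0) at_top"
proof -
  \<comment> \<open>Support radii add under convolution: \<open>h (x - y) * g y\<close> vanishes as
    soon as \<open>norm x\<close> exceeds twice the common radius.\<close>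
  define B' where "B' = \<bar>B\<bar> + \<bar>B\<bar>"
  obtain M where M: "M > 0" "\<And>x. \<bar>h x\<bar> \<le> M"
    using bounded_vanishing[OF h] by auto
  obtain K where K: "K \<ge> 0" "\<forall>\<^sub>F s in at_top. real (card (cylinder \<Gamma> s B')) \<le> K * s ^ DIM('a)"
    using card_cylinder_le by blast
  have int_g: "integrable lborel g"
    using integrable_vanishing[OF g] .
  have van: "h (x - y) = 0" if "norm x > B'" "norm y \<le> B" for x y
    using that norm_triangle_ineq2[of x y] by (auto intro!: h(2) simp: B'_def)
  have van': "h (x - y) * g y = 0" if "norm x > B'" for x y
    using van[OF that, of y] g(2)[of y] by (cases "norm y \<le> B") auto
  have int_hg: "integrable lborel (\<lambda>y. h (x - y) * g y)" for x
  proof (rule integrable_vanishing[where B=B])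
    show "continuous_on UNIV (\<lambda>y. h (x - y) * g y)"
      by (intro continuous_intros continuous_on_compose2[OF h(1)] g(1)) auto
  qed (simp add: g(2))
  \<comment> \<open>Written with sums over one fixed finite cylinder, so that measurability in
    \<open>y\<close> is evident. Where \<open>g y\<close> is nonzero, \<open>norm y \<le> B\<close>
    and the cylinder sums are the layer sums; elsewhere the factor \<open>g y\<close> kills the
    difference.\<close>
  define F where "F s y = g y * (((\<Sum>\<gamma>\<in>cylinder \<Gamma> s B'. h (snd \<gamma> - y)) - (\<Sum>\<gamma>\<in>cylinder \<Gamma> s B'. h (snd \<gamma>))) / s ^ DIM('a))" for s y
  have h0: "h x = 0" if "norm x > B'" for x
    using that by (auto intro!: h(2) simp: B'_def)
  have F: "F s y = g y * ((layer_sum \<Gamma> (\<lambda>x. h (x - y)) s - layer_sum \<Gamma> h s) / s ^ DIM('a))" for s y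
  proof (cases "norm y \<le> B")
    case True
    then show ?thesis unfolding F_def using layer_sum_eq[OF van[OF _ True]] layer_sum_eq[of B' h] h0 by simp
  qed (simp add: F_def g(2))
  have eq: "(LINT y|lborel. F s y) = (layer_sum \<Gamma> (\<lambda>x. LINT y|lborel. h (x - y) * g y) s
      - layer_sum \<Gamma> h s * (LINT y|lborel. g y)) / s ^ DIM('a)" for s
  proof -
    have "layer_sum \<Gamma> (\<lambda>x. LINT y|lborel. h (x - y) * g y) s
       = (\<Sum>\<gamma>\<in>cylinder \<Gamma> s B'. LINT y|lborel. h (snd \<gamma> - y) * g y)"
      by (rule layer_sum_eq) (simp add: van')
    also have "\<dots> = (LINT y|lborel. (\<Sum>\<gamma>\<in>cylinder \<Gamma> s B'. h (snd \<gamma> - y) * g y))"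
      by (intro Bochner_Integration.integral_sum[symmetric] int_hg)
    finally have "layer_sum \<Gamma> (\<lambda>x. LINT y|lborel. h (x - y) * g y) s - layer_sum \<Gamma> h s * (LINT y|lborel. g y)
       = (LINT y|lborel. (\<Sum>\<gamma>\<in>cylinder \<Gamma> s B'. h (snd \<gamma> - y) * g y) - (\<Sum>\<gamma>\<in>cylinder \<Gamma> s B'. h (snd \<gamma>)) * g y)"
      using int_g int_hg layer_sum_eq[of B' h] h0
      by (subst Bochner_Integration.integral_diff) (auto intro!: Bochner_Integration.integrable_sum)
    moreover have "F s = (\<lambda>y. ((\<Sum>\<gamma>\<in>cylinder \<Gamma> s B'. h (snd \<gamma> - y) * g y) - (\<Sum>\<gamma>\<in>cylinder \<Gamma> s B'. h (snd \<gamma>)) * g y) / s ^ DIM('a))"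
      by (simp add: F_def fun_eq_iff sum_distrib_left right_diff_distrib diff_divide_distrib mult.commute)
    ultimately show ?thesis by simp
  qed
  \<comment> \<open>Dominated convergence: pointwise convergence is asymptotic translation
    invariance, and the cylinder count \<open>K * s^m\<close> makes a multiple of \<open>|g|\<close>
    an eventual majorant.\<close>
  have "((\<lambda>s. LINT y|lborel. F s y) \<longlongrightarrow> (LINT y::'b|lborel. 0)) at_top"
  proof (rule integral_dominated_convergence_at_top[where w="\<lambda>y. 2 * M * K * \<bar>g y\<bar>"])
    show "integrable lborel (\<lambda>y. 2 * M * K * \<bar>g y\<bar>)"
      using int_g by auto
    show "AE y in lborel. ((\<lambda>s. F s y) \<longlongrightarrow> 0) at_top"
    proof (rule AE_I2)
      fix y
      show "((\<lambda>s. F s y) \<longlongrightarrow> 0) at_top"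
        unfolding F by (intro tendsto_mult_right_zero layer_sum_translate[OF h])
    qed
    show "F s \<in> borel_measurable lborel" for s
      unfolding F_def divide_inverse
      by (auto intro!: borel_measurable_continuous_onI continuous_intros continuous_on_compose2[OF h(1)] g(1))
    show "\<forall>\<^sub>F s in at_top. AE y in lborel. norm (F s y) \<le> 2 * M * K * \<bar>g y\<bar>"
      using K(2) eventually_gt_at_top[of 0]
    proof eventually_elim
      case (elim s)
      have "\<bar>\<Sum>\<gamma>\<in>cylinder \<Gamma> s B'. f \<gamma>\<bar> \<le> M * (K * s ^ DIM('a))" if "\<And>\<gamma>. \<bar>f \<gamma>\<bar> \<le> M" for f
      proof -
        have "\<bar>\<Sum>\<gamma>\<in>cylinder \<Gamma> s B'. f \<gamma>\<bar> \<le> (\<Sum>\<gamma>\<in>cylinder \<Gamma> s B'. \<bar>f \<gamma>\<bar>)"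
          by (rule sum_abs)
        also have "\<dots> \<le> real (card (cylinder \<Gamma> s B')) * M"
          by (rule sum_bounded_above) (rule that)
        also have "\<dots> \<le> M * (K * s ^ DIM('a))"
          using elim M(1) by (simp add: mult.commute)
        finally show ?thesis .
      qed
      note bound = this
      have "\<bar>(\<Sum>\<gamma>\<in>cylinder \<Gamma> s B'. h (snd \<gamma> - y)) - (\<Sum>\<gamma>\<in>cylinder \<Gamma> s B'. h (snd \<gamma>))\<bar> \<le> 2 * M * K * s ^ DIM('a)" for y
      proof -
        have "\<bar>\<Sum>\<gamma>\<in>cylinder \<Gamma> s B'. h (snd \<gamma> - y)\<bar> \<le> M * (K * s ^ DIM('a))"
          "\<bar>\<Sum>\<gamma>\<in>cylinder \<Gamma> s B'. h (snd \<gamma>)\<bar> \<le> M * (K * s ^ DIM('a))"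
          using M(2) by (auto intro: bound)
        then show ?thesis by linarith
      qed
      then have "\<bar>(\<Sum>\<gamma>\<in>cylinder \<Gamma> s B'. h (snd \<gamma> - y)) - (\<Sum>\<gamma>\<in>cylinder \<Gamma> s B'. h (snd \<gamma>))\<bar> / s ^ DIM('a) \<le> 2 * M * K" for y
        using elim by (simp add: pos_divide_le_eq)
      then have "\<bar>g y\<bar> * (\<bar>(\<Sum>\<gamma>\<in>cylinder \<Gamma> s B'. h (snd \<gamma> - y)) - (\<Sum>\<gamma>\<in>cylinder \<Gamma> s B'. h (snd \<gamma>))\<bar> / s ^ DIM('a)) \<le> \<bar>g y\<bar> * (2 * M * K)" for y
        by (intro mult_left_mono) auto
      then show ?case
        using elim by (intro AE_I2) (simp add: F_def abs_mult abs_divide mult.commute)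
    qed
  qed simp
  then show ?thesis
    unfolding eq by simp
qed

lemma layer_sum_proportional:
  assumes h: "continuous_on UNIV h" "\<And>x. norm x > B \<Longrightarrow> h x = 0"
    and g: "continuous_on UNIV g" "\<And>x. norm x > B \<Longrightarrow> g x = 0"
  shows "((\<lambda>s. (layer_sum \<Gamma> h s * (LINT y|lborel. g y) - layer_sum \<Gamma> g s * (LINT y|lborel. h y)) / s ^ DIM('a)) \<longlongrightarrow> 0) at_top"
proof -
  have "(\<lambda>x. LINT y|lborel. h (x - y) * g y) = (\<lambda>x. LINT y|lborel. g (x - y) * h y)"
    by (intro ext convolution_commute h(1) g(1))
  with tendsto_diff[OF layer_sum_convolution[OF g h] layer_sum_convolution[OF h g]]
  show ?thesis
    by (simp add: diff_divide_distrib algebra_simps)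
qed

text \<open>A single normalisation serves all test functions: the layer sum of a trapezoidal bump
  \<open>g\<close> divided by its integral. Since \<open>g\<close> is 1 on the ball of radius
  \<open>B\<^sub>0\<close>, its layer sum dominates the cylinder count and so is at least
  \<open>c * s^m\<close>; this turns the \<open>o(s^m)\<close> error of proportionality into a
  vanishing relative error.\<close>

lemma layer_sum_asymptotic:
  obtains N where "\<forall>\<^sub>F s in at_top. N s > 0"
    and "\<And>h B. continuous_on UNIV h \<Longrightarrow> (\<And>x. norm x > B \<Longrightarrow> h x = 0) \<Longrightarrow>
        ((\<lambda>s. layer_sum \<Gamma> h s / N s) \<longlongrightarrow> (LINT y|lborel. h y)) at_top"
proof -
  obtain c B\<^sub>0 where c: "c > 0" "B\<^sub>0 > 0" "\<forall>\<^sub>F s in at_top. c * s ^ DIM('a) \<le> real (card (cylinder \<Gamma> s B\<^sub>0))"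
    using card_cylinder_ge by blast
  define g where "g x = max 0 (min 1 (B\<^sub>0 + 1 - norm x))" for x :: 'b
  have cont: "continuous_on UNIV g"
    unfolding g_def by (intro continuous_intros)
  have van: "g x = 0" if "norm x > B\<^sub>0 + 1" for x
    using that unfolding g_def by simp
  have g1: "g x = 1" if "norm x \<le> B\<^sub>0" for x
    using that unfolding g_def by simp
  have g0: "g x \<ge> 0" for x unfolding g_def by simp
  define I where "I = (LINT y|lborel. g y)"
  have I: "I > 0"
  proof -
    have "0 < measure lborel (cball (0::'b) B\<^sub>0)"
      using c(2) by simp
    also have "\<dots> = (LINT y|lborel. indicator (cball (0::'b) B\<^sub>0) y)"
      by simp
    also have "\<dots> \<le> I"
      unfolding I_def
    proof (rule integral_mono)
      show "integrable lborel (indicator (cball (0::'b) B\<^sub>0) :: _ \<Rightarrow> real)"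
        using emeasure_bounded_finite[OF bounded_cball, of "0::'b" B\<^sub>0] by (intro integrable_real_indicator) auto
      show "integrable lborel g"
        using cont van by (rule integrable_vanishing)
    qed (auto simp: indicator_def g1 g0)
    finally show ?thesis .
  qed
  have low: "c * s ^ DIM('a) \<le> layer_sum \<Gamma> g s" if "c * s ^ DIM('a) \<le> real (card (cylinder \<Gamma> s B\<^sub>0))" for s
  proof -
    have "real (card (cylinder \<Gamma> s B\<^sub>0)) = (\<Sum>\<gamma>\<in>cylinder \<Gamma> s B\<^sub>0. g (snd \<gamma>))"
      by (simp add: g1 cylinder_def)
    also have "\<dots> \<le> (\<Sum>\<gamma>\<in>cylinder \<Gamma> s (B\<^sub>0 + 1). g (snd \<gamma>))"
      using g0 by (intro sum_mono2 finite_cylinder) (auto simp: cylinder_def)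
    also have "\<dots> = layer_sum \<Gamma> g s"
      using van by (rule layer_sum_eq[symmetric])
    finally show ?thesis using that by linarith
  qed
  define N where "N s = layer_sum \<Gamma> g s / I" for s
  show ?thesis
  proof
    show "\<forall>\<^sub>F s in at_top. N s > 0"
      using c(3) eventually_gt_at_top[of 0]
    proof eventually_elim
      case (elim s)
      then have "c * s ^ DIM('a) > 0" using c(1) by simp
      with low[of s] elim have "layer_sum \<Gamma> g s > 0" by linarith
      then show ?case unfolding N_def using I by simp
    qed
    fix h :: "'b \<Rightarrow> real" and B assume h: "continuous_on UNIV h" and hB: "\<And>x. norm x > B \<Longrightarrow> h x = 0"
    define B' where "B' = max B (B\<^sub>0 + 1)"
    define D where "D s = (layer_sum \<Gamma> h s * I - layer_sum \<Gamma> g s * (LINT y|lborel. h y)) / s ^ DIM('a)" for s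
    have D: "(D \<longlongrightarrow> 0) at_top"
      unfolding D_def I_def
      by (rule layer_sum_proportional[where B=B']) (auto simp: B'_def h hB cont van)
    have "((\<lambda>s. layer_sum \<Gamma> h s / N s - (LINT y|lborel. h y)) \<longlongrightarrow> 0) at_top"
    proof (rule Lim_null_comparison)
      show "\<forall>\<^sub>F s in at_top. norm (layer_sum \<Gamma> h s / N s - (LINT y|lborel. h y)) \<le> \<bar>D s\<bar> / c"
        using c(3) eventually_gt_at_top[of 0]
      proof eventually_elim
        case (elim s)
        then have sp: "s ^ DIM('a) > 0" by simp
        then have "c * s ^ DIM('a) > 0" using c(1) by simp
        with low[of s] elim have G: "layer_sum \<Gamma> g s > 0" "c * s ^ DIM('a) \<le> layer_sum \<Gamma> g s" by auto
        have "layer_sum \<Gamma> h s / N s - (LINT y|lborel. h y) = (D s * s ^ DIM('a)) / layer_sum \<Gamma> g s"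
          unfolding N_def D_def using G I elim(2) by (simp add: divide_simps)
        also have "norm \<dots> = \<bar>D s\<bar> * s ^ DIM('a) / layer_sum \<Gamma> g s"
          using G elim by (simp add: abs_mult)
        also have "\<dots> \<le> \<bar>D s\<bar> * s ^ DIM('a) / (c * s ^ DIM('a))"
          using G \<open>c * s ^ DIM('a) > 0\<close> sp by (intro divide_left_mono mult_nonneg_nonneg) auto
        also have "\<dots> = \<bar>D s\<bar> / c" using elim(2) by simp
        finally show ?case .
      qed
      show "((\<lambda>s. \<bar>D s\<bar> / c) \<longlongrightarrow> 0) at_top"
        using tendsto_divide[OF tendsto_rabs_zero[OF D] tendsto_const, of c] c(1) by simp
    qed
    then show "((\<lambda>s. layer_sum \<Gamma> h s / N s) \<longlongrightarrow> (LINT y|lborel. h y)) at_top"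
      by (simp add: LIM_zero_iff)
  qed
qed

section \<open>From continuous test functions to windows with null boundary\<close>

lemma layer_sum_mono:
  assumes "\<And>x. norm x > B \<Longrightarrow> h x = 0" "\<And>x. norm x > B \<Longrightarrow> g x = 0" "\<And>x. h x \<le> g x"
  shows "layer_sum \<Gamma> h s \<le> layer_sum \<Gamma> g s"
  using layer_sum_eq[of B h] layer_sum_eq[of B g] assms by (simp add: sum_mono)

text \<open>Built from distance functions, \<open>hp j\<close> decreases to the indicator of the
  closed set \<open>U\<close> times \<open>\<phi>\<close>, and \<open>hm j\<close> increases to the
  same limit off the frontier. As the frontier is null, both integrals converge to the integral over
  the window, and monotonicity of layer sums squeezes it.\<close>

lemma layer_sum_window_nonneg:
  assumes N: "\<forall>\<^sub>F s in at_top. N s > 0"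
    "\<And>h B. continuous_on UNIV h \<Longrightarrow> (\<And>x. norm x > B \<Longrightarrow> h x = 0) \<Longrightarrow>
        ((\<lambda>s. layer_sum \<Gamma> h s / N s) \<longlongrightarrow> (LINT y|lborel. h y)) at_top"
    and U: "compact U" "U \<noteq> {}" "frontier U \<in> null_sets lborel"
    and \<phi>: "continuous_on UNIV \<phi>" "\<And>x. \<phi> x \<ge> 0"
  shows "((\<lambda>s. layer_sum \<Gamma> (\<lambda>x. indicator U x * \<phi> x) s / N s) \<longlongrightarrow> (LINT x|lborel. indicator U x * \<phi> x)) at_top"
proof -
  obtain B where B: "\<And>x. x \<in> U \<Longrightarrow> norm x \<le> B"
    using compact_imp_bounded[OF U(1)] unfolding bounded_iff by blast
  have closed: "closed U" using U(1) by (rule compact_imp_closed)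
  \<comment> \<open>The distance to the empty set is 0 by convention, which would spoil
    \<open>hm\<close>.\<close>
  have ne: "- U \<noteq> {}"
    using compact_imp_bounded[OF U(1)] not_bounded_UNIV by (metis Compl_empty_eq double_complement)
  \<comment> \<open>The slope \<open>Suc j\<close> is at least 1, so every \<open>hp j\<close>
    vanishes at distance 1 from \<open>U\<close>, that is, beyond norm \<open>B + 1\<close>.\<close>
  define hp where "hp j x = \<phi> x * max 0 (1 - real (Suc j) * infdist x U)" for j x
  define hm where "hm j x = \<phi> x * min 1 (real (Suc j) * infdist x (- U))" for j x
  define I where "I = (LINT x|lborel. indicator U x * \<phi> x)"
  define w where "w x = indicator (cball 0 (B + 1)) x * \<phi> x" for x
  have cont: "continuous_on UNIV (hp j)" "continuous_on UNIV (hm j)" for j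
    unfolding hp_def hm_def by (intro continuous_intros \<phi>(1) continuous_on_infdist)+
  have van: "hp j x = 0" "hm j x = 0" "indicator U x * \<phi> x = 0" if "norm x > B + 1" for j x
  proof -
    obtain y where y: "y \<in> U" "infdist x U = dist x y"
      using infdist_attains_inf[OF closed U(2)] by blast
    have "1 \<le> infdist x U"
      using y that B[OF y(1)] norm_triangle_ineq2[of x y] by (simp add: dist_norm)
    then have "1 \<le> real (Suc j) * infdist x U"
      using mult_mono[of 1 "real (Suc j)" 1 "infdist x U"] by simp
    then show "hp j x = 0" unfolding hp_def by simp
    have "x \<notin> U" using B[of x] that by auto
    then show "hm j x = 0" "indicator U x * \<phi> x = 0" unfolding hm_def by auto
  qed
  have ge: "hm j x \<le> indicator U x * \<phi> x" "indicator U x * \<phi> x \<le> hp j x" for j x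
    using \<phi>(2)[of x] unfolding hp_def hm_def
    by (cases "x \<in> U"; simp add: mult_left_le)+
  have bound: "norm (hp j x) \<le> w x" "norm (hm j x) \<le> w x" for j x
  proof -
    have "norm (hp j x) \<le> \<phi> x" "norm (hm j x) \<le> \<phi> x"
      using \<phi>(2)[of x] infdist_nonneg[of x U] infdist_nonneg[of x "- U"]
      unfolding hp_def hm_def by (auto simp: abs_mult intro!: mult_left_le)
    moreover have "w x = 0 \<Longrightarrow> \<phi> x = 0 \<or> norm x > B + 1" "norm x \<le> B + 1 \<Longrightarrow> w x = \<phi> x"
      unfolding w_def by (auto simp: indicator_def split: if_splits)
    ultimately show "norm (hp j x) \<le> w x" "norm (hm j x) \<le> w x"
      using van(1)[of x j] van(2)[of x j] \<phi>(2)[of x]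
      by (cases "norm x \<le> B + 1"; simp add: w_def)+
  qed
  have int_w: "integrable lborel w"
    unfolding w_def using borel_integrable_compact[OF compact_cball, of 0 "B + 1" \<phi>] \<phi>(1)
    by (auto intro: continuous_on_subset)
  have meas: "(\<lambda>x. indicator U x * \<phi> x) \<in> borel_measurable borel"
    using closed \<phi>(1) by (intro borel_measurable_times borel_measurable_indicator borel_measurable_continuous_onI) auto
  have big: "\<forall>\<^sub>F j in sequentially. 1 \<le> real (Suc j) * d" if d: "d > 0" for d
  proof -
    obtain k where "1 / d \<le> real k" using real_arch_simple by blast
    then have k: "1 \<le> real k * d" using d by (simp add: pos_divide_le_eq)
    have "1 \<le> real (Suc j) * d" if "j \<ge> k" for j
      using that d by (intro order_trans[OF k] mult_right_mono) auto
    then show ?thesis unfolding eventually_sequentially by blast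
  qed
  have hp_lim: "(\<lambda>j. hp j x) \<longlonglongrightarrow> indicator U x * \<phi> x" for x
  proof (cases "x \<in> U")
    case True then show ?thesis unfolding hp_def by simp
  next
    case False
    then have "infdist x U > 0"
      by (rule infdist_pos_not_in_closed[OF closed U(2)])
    from big[OF this] have "\<forall>\<^sub>F j in sequentially. hp j x = indicator U x * \<phi> x"
      by eventually_elim (simp add: hp_def False)
    then show ?thesis by (rule tendsto_eventually)
  qed
  have hm_lim: "(\<lambda>j. hm j x) \<longlonglongrightarrow> indicator U x * \<phi> x" if "x \<notin> frontier U" for x
  proof (cases "x \<in> U")
    case False then show ?thesis unfolding hm_def by simp
  next
    case True
    then have "x \<notin> closure (- U)"
      using that closure_closed[OF closed] by (simp add: frontier_def closure_complement)
    then have "infdist x (- U) > 0"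
      using in_closure_iff_infdist_zero[OF ne, of x] infdist_nonneg[of x "- U"] by linarith
    from big[OF this] have "\<forall>\<^sub>F j in sequentially. hm j x = indicator U x * \<phi> x"
      by eventually_elim (simp add: hm_def True)
    then show ?thesis by (rule tendsto_eventually)
  qed
  have "AE x in lborel. x \<notin> frontier U"
    using U(3) by (rule AE_not_in)
  then have "(\<lambda>j. LINT x|lborel. hm j x) \<longlonglongrightarrow> I"
    unfolding I_def
    by (intro integral_dominated_convergence[where w=w])
       (auto simp: meas int_w bound cont intro!: borel_measurable_continuous_onI hm_lim bound[unfolded real_norm_def])
  moreover have "(\<lambda>j. LINT x|lborel. hp j x) \<longlonglongrightarrow> I"
    unfolding I_def
    by (intro integral_dominated_convergence[where w=w])
       (auto simp: meas int_w bound cont intro!: borel_measurable_continuous_onI hp_lim bound[unfolded real_norm_def])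
  ultimately show ?thesis
    unfolding I_def[symmetric]
  proof (intro order_tendstoI)
    fix a assume lim: "(\<lambda>j. LINT x|lborel. hm j x) \<longlonglongrightarrow> I" and a: "a < I"
    obtain j where "a < (LINT x|lborel. hm j x)"
      using order_tendstoD(1)[OF lim a] by (auto simp: eventually_sequentially)
    moreover have "((\<lambda>s. layer_sum \<Gamma> (hm j) s / N s) \<longlongrightarrow> (LINT x|lborel. hm j x)) at_top"
      using cont(2) van(2) by (rule N(2))
    ultimately have "\<forall>\<^sub>F s in at_top. a < layer_sum \<Gamma> (hm j) s / N s"
      by (rule order_tendstoD(1)[rotated])
    from this N(1)
    show "\<forall>\<^sub>F s in at_top. a < layer_sum \<Gamma> (\<lambda>x. indicator U x * \<phi> x) s / N s"
    proof eventually_elim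
      case (elim s)
      moreover have "layer_sum \<Gamma> (hm j) s \<le> layer_sum \<Gamma> (\<lambda>x. indicator U x * \<phi> x) s"
        using van(2,3) ge(1) by (rule layer_sum_mono)
      ultimately show ?case
        by (meson divide_right_mono less_imp_le less_le_trans)
    qed
  next
    fix a assume lim: "(\<lambda>j. LINT x|lborel. hp j x) \<longlonglongrightarrow> I" and a: "I < a"
    obtain j where "(LINT x|lborel. hp j x) < a"
      using order_tendstoD(2)[OF lim a] by (auto simp: eventually_sequentially)
    moreover have "((\<lambda>s. layer_sum \<Gamma> (hp j) s / N s) \<longlongrightarrow> (LINT x|lborel. hp j x)) at_top"
      using cont(1) van(1) by (rule N(2))
    ultimately have "\<forall>\<^sub>F s in at_top. layer_sum \<Gamma> (hp j) s / N s < a"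
      by (rule order_tendstoD(2)[rotated])
    from this N(1)
    show "\<forall>\<^sub>F s in at_top. layer_sum \<Gamma> (\<lambda>x. indicator U x * \<phi> x) s / N s < a"
    proof eventually_elim
      case (elim s)
      moreover have "layer_sum \<Gamma> (\<lambda>x. indicator U x * \<phi> x) s \<le> layer_sum \<Gamma> (hp j) s"
        using van(3,1) ge(2) by (rule layer_sum_mono)
      ultimately show ?case
        by (meson divide_right_mono less_imp_le le_less_trans)
    qed
  qed
qed

text \<open>Splitting into positive and negative parts reduces to the non-negative case. The
  constant function 1 gives the denominator, and the unknown \<open>N\<close> cancels in the
  quotient.\<close>

lemma layer_sum_window:
  assumes U: "compact U" "interior U \<noteq> {}" "frontier U \<in> null_sets lborel"
    and \<phi>: "continuous_on UNIV \<phi>"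
  shows "((\<lambda>s. layer_sum \<Gamma> (\<lambda>x. indicator U x * \<phi> x) s / layer_sum \<Gamma> (indicator U) s)
      \<longlongrightarrow> (LINT x|lborel. indicator U x * \<phi> x) / measure lborel U) at_top"
proof -
  obtain N where N: "\<forall>\<^sub>F s in at_top. N s > 0"
    "\<And>h B. continuous_on UNIV h \<Longrightarrow> (\<And>x. norm x > B \<Longrightarrow> h x = 0) \<Longrightarrow>
        ((\<lambda>s. layer_sum \<Gamma> h s / N s) \<longlongrightarrow> (LINT y|lborel. h y)) at_top"
    using layer_sum_asymptotic by blast
  obtain B where B: "\<And>x. x \<in> U \<Longrightarrow> norm x \<le> B"
    using compact_imp_bounded[OF U(1)] unfolding bounded_iff by blast
  have ne: "U \<noteq> {}" using U(2) interior_subset by blast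
  have van: "indicator U x * g x = (0::real)" if "norm x > B" for x g
    using that B[of x] by (auto simp: indicator_def)
  have pos: "measure lborel U > 0"
  proof -
    obtain x e where e: "e > 0" "ball x e \<subseteq> U"
      using U(2) by (metis all_not_in_conv mem_interior)
    have "0 < measure lborel (ball x e)" using e(1) by simp
    also have "\<dots> \<le> measure lborel U"
      using e(2) U(1) by (intro measure_mono_fmeasurable fmeasurable_compact) auto
    finally show ?thesis .
  qed
  have int: "integrable lborel (\<lambda>x. indicator U x * g x)" if "continuous_on UNIV g" for g :: "'b \<Rightarrow> real"
    using borel_integrable_compact[OF U(1), of g] that by (auto intro: continuous_on_subset)
  define \<phi>p where "\<phi>p x = max 0 (\<phi> x)" for x
  define \<phi>m where "\<phi>m x = max 0 (- \<phi> x)" for x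
  have cont: "continuous_on UNIV \<phi>p" "continuous_on UNIV \<phi>m"
    unfolding \<phi>p_def \<phi>m_def by (intro continuous_intros \<phi>)+
  have split: "indicator U x * \<phi> x = indicator U x * \<phi>p x - indicator U x * \<phi>m x" for x
    unfolding \<phi>p_def \<phi>m_def by (auto simp: max_def)
  have "layer_sum \<Gamma> (\<lambda>x. indicator U x * \<phi> x) s = layer_sum \<Gamma> (\<lambda>x. indicator U x * \<phi>p x) s - layer_sum \<Gamma> (\<lambda>x. indicator U x * \<phi>m x) s" for s
  proof -
    have *: "layer_sum \<Gamma> (\<lambda>x. indicator U x * g x) s = (\<Sum>\<gamma>\<in>cylinder \<Gamma> s B. indicator U (snd \<gamma>) * g (snd \<gamma>))" for g
      using van by (rule layer_sum_eq)
    then show ?thesis unfolding * by (simp add: split sum_subtractf)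
  qed
  moreover have "(LINT x|lborel. indicator U x * \<phi> x) = (LINT x|lborel. indicator U x * \<phi>p x) - (LINT x|lborel. indicator U x * \<phi>m x)"
    unfolding split by (intro Bochner_Integration.integral_diff int cont)
  moreover have "((\<lambda>s. layer_sum \<Gamma> (\<lambda>x. indicator U x * g x) s / N s) \<longlongrightarrow> (LINT x|lborel. indicator U x * g x)) at_top"
    if "continuous_on UNIV g" "\<And>x. g x \<ge> 0" for g
    using N U(1) ne U(3) that by (rule layer_sum_window_nonneg)
  note window = this
  have "((\<lambda>s. layer_sum \<Gamma> (\<lambda>x. indicator U x * \<phi>p x) s / N s - layer_sum \<Gamma> (\<lambda>x. indicator U x * \<phi>m x) s / N s)
     \<longlongrightarrow> (LINT x|lborel. indicator U x * \<phi>p x) - (LINT x|lborel. indicator U x * \<phi>m x)) at_top"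
    by (intro tendsto_diff window cont) (auto simp: \<phi>p_def \<phi>m_def)
  ultimately have 1: "((\<lambda>s. layer_sum \<Gamma> (\<lambda>x. indicator U x * \<phi> x) s / N s) \<longlongrightarrow> (LINT x|lborel. indicator U x * \<phi> x)) at_top"
    by (simp add: diff_divide_distrib)
  have 2: "((\<lambda>s. layer_sum \<Gamma> (indicator U) s / N s) \<longlongrightarrow> measure lborel U) at_top"
    using window[of "\<lambda>_. 1"] by simp
  have "((\<lambda>s. (layer_sum \<Gamma> (\<lambda>x. indicator U x * \<phi> x) s / N s) / (layer_sum \<Gamma> (indicator U) s / N s))
      \<longlongrightarrow> (LINT x|lborel. indicator U x * \<phi> x) / measure lborel U) at_top"
    using 1 2 pos by (intro tendsto_divide) auto
  moreover have "\<forall>\<^sub>F s in at_top. (layer_sum \<Gamma> (\<lambda>x. indicator U x * \<phi> x) s / N s) / (layer_sum \<Gamma> (indicator U) s / N s)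
       = layer_sum \<Gamma> (\<lambda>x. indicator U x * \<phi> x) s / layer_sum \<Gamma> (indicator U) s"
    using N(1) by eventually_elim simp
  ultimately show ?thesis
    by (rule Lim_transform_eventually)
qed

end

section \<open>Characters and Fourier transforms\<close>

definition character :: "real^'n \<Rightarrow> real^'n \<Rightarrow> complex" where
  "character k x = exp (- (2 * of_real pi * \<i>) * of_real (k \<bullet> x))"

lemma character_eq: "character k x = exp (\<i> * of_real (- (2 * pi * (k \<bullet> x))))"
  by (simp add: character_def algebra_simps)

lemma Re_character: "Re (character k x) = cos (2 * pi * (k \<bullet> x))"
  and Im_character: "Im (character k x) = - sin (2 * pi * (k \<bullet> x))"
  unfolding character_eq by (simp_all add: Re_exp Im_exp)

lemma norm_character [simp]: "norm (character k x) = 1"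
  unfolding character_eq by (rule norm_exp_i_times)

lemma character_0 [simp]: "character 0 x = 1" "character k 0 = 1"
  by (simp_all add: character_def)

lemma character_add_right: "character k (x + y) = character k x * character k y"
  by (simp add: character_def inner_add_right exp_add[symmetric] algebra_simps)

lemma character_adjoint:
  assumes "linear A"
  shows "character k (A x) = character (adjoint A k) x"
  using adjoint_works[OF assms, of x k] by (simp add: character_def inner_commute)

lemma continuous_character: "continuous_on S (character k)"
  unfolding character_def by (intro continuous_intros)

lemma character_measurable [measurable]: "character k \<in> borel_measurable borel"
  by (rule borel_measurable_continuous_onI[OF continuous_character])

text \<open>After the unimodular factor \<open>character l x\<close> is split off,
  \<open>|exp(it) - 1| = 2 |sin(t/2)| \<le> |t|\<close> and Cauchy-Schwarz apply. On a bounded set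
  the characters are thus uniformly Lipschitz in the frequency, the source of every Lipschitz
  constant below.\<close>

lemma character_diff_le: "norm (character k x - character l x) \<le> 2 * pi * norm (k - l) * norm x"
proof -
  have "character k x - character l x = character l x * (character (k - l) x - 1)"
    by (simp add: character_def exp_add[symmetric] inner_diff_left algebra_simps)
  then have "norm (character k x - character l x) = norm (character (k - l) x - 1)"
    by (simp add: norm_mult)
  also have "\<dots> = 2 * \<bar>sin (- (2 * pi * ((k - l) \<bullet> x)) / 2)\<bar>"
    unfolding character_eq by (rule dist_exp_i_1)
  also have "\<dots> \<le> 2 * \<bar>- (2 * pi * ((k - l) \<bullet> x)) / 2\<bar>"
    by (intro mult_left_mono abs_sin_x_le_abs_x) auto
  also have "\<dots> = 2 * pi * \<bar>(k - l) \<bullet> x\<bar>"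
    by (simp add: abs_mult)
  also have "\<dots> \<le> 2 * pi * (norm (k - l) * norm x)"
    by (intro mult_left_mono Cauchy_Schwarz_ineq2) auto
  finally show ?thesis by (simp add: mult.assoc)
qed

lemma character_minus_1_le: "norm (character k x - 1) \<le> 2 * pi * norm k * norm x"
  using character_diff_le[of k x 0] by simp

section \<open>Probability measures carried by a window\<close>

text \<open>Common interface for the Hutchinson measures and \<open>density_measure f\<close>:
  estimates proved for it depend on \<open>\<Omega>\<close> alone, hence are uniform in
  \<open>s\<close>.\<close>

definition prob_on :: "(real^'n) set \<Rightarrow> (real^'n) measure \<Rightarrow> bool" where
  "prob_on \<Omega> M \<longleftrightarrow> sets M = sets borel \<and> emeasure M UNIV = 1 \<and> emeasure M (- \<Omega>) = 0"

lemma prob_on_AE: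
  assumes "prob_on \<Omega> M" "\<Omega> \<in> sets borel"
  shows "AE x in M. x \<in> \<Omega>"
proof -
  have "- \<Omega> \<in> null_sets M"
    using assms by (auto simp: prob_on_def null_sets_def borel_comp)
  from AE_not_in[OF this] show ?thesis by simp
qed

lemma prob_on_finite:
  assumes "prob_on \<Omega> M"
  shows "finite_measure M" "space M = UNIV" "measure M UNIV = 1"
proof -
  show space: "space M = UNIV"
    using assms sets_eq_imp_space_eq[of M borel] by (simp add: prob_on_def)
  show "finite_measure M"
    using assms by (intro finite_measureI) (simp add: space prob_on_def)
  show "measure M UNIV = 1"
    using assms by (simp add: prob_on_def measure_def)
qed

lemma prob_on_integrable:
  fixes \<phi> :: "real^'n \<Rightarrow> 'b::{banach, second_countable_topology}"
  assumes "prob_on \<Omega> M" "\<Omega> \<in> sets borel" "\<phi> \<in> borel_measurable borel" "\<And>x. x \<in> \<Omega> \<Longrightarrow> norm (\<phi> x) \<le> C"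
  shows "integrable M \<phi>"
proof (rule finite_measure.integrable_const_bound[OF prob_on_finite(1)[OF assms(1)]])
  show "AE x in M. norm (\<phi> x) \<le> C"
    using prob_on_AE[OF assms(1,2)] by eventually_elim (rule assms(4))
  show "\<phi> \<in> borel_measurable M"
    using assms(1,3) measurable_cong_sets[of M borel borel borel] unfolding prob_on_def by blast
qed

lemma prob_on_integral_norm_le:
  fixes \<phi> :: "real^'n \<Rightarrow> 'b::{banach, second_countable_topology}"
  assumes "prob_on \<Omega> M" "\<Omega> \<in> sets borel" "\<phi> \<in> borel_measurable borel" "\<And>x. x \<in> \<Omega> \<Longrightarrow> norm (\<phi> x) \<le> C"
  shows "norm (integral\<^sup>L M \<phi>) \<le> C"
proof -
  interpret finite_measure M by (rule prob_on_finite(1)[OF assms(1)])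
  have "norm (integral\<^sup>L M \<phi>) \<le> (LINT x|M. norm (\<phi> x))"
    by (rule integral_norm_bound)
  also have "\<dots> \<le> (LINT x|M. C)"
  proof (rule integral_mono_AE)
    show "AE x in M. norm (\<phi> x) \<le> C"
      using prob_on_AE[OF assms(1,2)] by eventually_elim (rule assms(4))
    show "integrable M (\<lambda>x. norm (\<phi> x))"
      using prob_on_integrable[OF assms] by simp
  qed simp
  also have "\<dots> = C"
    using prob_on_finite(2,3)[OF assms(1)] by simp
  finally show ?thesis .
qed

lemma fourier_character: "fourier M k = (LINT x|M. character k x)"
  unfolding fourier_def character_def ..

lemma fourier_0:
  assumes "prob_on \<Omega> M"
  shows "fourier M 0 = 1"
  using prob_on_finite[OF assms] by (simp add: fourier_character)

lemma fourier_Lipschitz: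
  assumes "prob_on \<Omega> M" "\<Omega> \<in> sets borel" "\<And>x. x \<in> \<Omega> \<Longrightarrow> norm x \<le> R"
  shows "norm (fourier M k - fourier M l) \<le> 2 * pi * R * norm (k - l)"
proof -
  have "fourier M k - fourier M l = (LINT x|M. character k x - character l x)"
    unfolding fourier_character
    by (intro Bochner_Integration.integral_diff[symmetric] prob_on_integrable[OF assms(1,2), of _ 1]) auto
  also have "norm \<dots> \<le> 2 * pi * R * norm (k - l)"
  proof (rule prob_on_integral_norm_le[OF assms(1,2)])
    fix x assume "x \<in> \<Omega>"
    have "norm (character k x - character l x) \<le> 2 * pi * norm (k - l) * norm x"
      by (rule character_diff_le)
    also have "\<dots> \<le> 2 * pi * norm (k - l) * R"
      using assms(3)[OF \<open>x \<in> \<Omega>\<close>] by (intro mult_left_mono) auto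
    finally show "norm (character k x - character l x) \<le> 2 * pi * R * norm (k - l)"
      by (simp add: mult_ac)
  qed simp
  finally show ?thesis .
qed

section \<open>Hutchinson measures\<close>

text \<open>Passes from the self-similarity of \<open>M\<close> on sets to integrals. The mixture is
  realised as the image \<open>N\<close> of the product of the uniform measure on \<open>T\<close>
  with \<open>M\<close> under \<open>(v, y) \<mapsto> t v y\<close>; Fubini computes integrals
  against \<open>N\<close>, and the identity on sets says \<open>N = M\<close>.\<close>

lemma integral_uniform_mixture:
  fixes \<phi> :: "'b::topological_space \<Rightarrow> 'c::{banach, second_countable_topology}"
  assumes "finite T" "T \<noteq> {}" "finite_measure M" "sets M = sets borel"
    and t: "\<And>v. v \<in> T \<Longrightarrow> t v \<in> borel_measurable borel"
    and eq: "\<And>Y. Y \<in> sets borel \<Longrightarrow> measure M Y = 1 / real (card T) * (\<Sum>v\<in>T. measure (distr M borel (t v)) Y)"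
    and "\<phi> \<in> borel_measurable borel" "\<And>x. norm (\<phi> x) \<le> C"
  shows "(LINT x|M. \<phi> x) = (1 / real (card T)) *\<^sub>R (\<Sum>v\<in>T. LINT y|M. \<phi> (t v y))"
proof -
  define U where "U = uniform_count_measure T"
  define P where "P = U \<Otimes>\<^sub>M M"
  define N where "N = distr P borel (\<lambda>(v, y). t v y)"
  interpret M: finite_measure M by fact
  interpret U: finite_measure U
    unfolding U_def using assms(1)
    by (intro finite_measureI) (simp add: space_uniform_count_measure emeasure_uniform_count_measure)
  interpret P: pair_sigma_finite U M ..
  interpret P': finite_measure P
    unfolding P_def by (rule finite_measure_pair_measure) unfold_locales
  have [measurable]: "(\<lambda>(v, y). t v y) \<in> P \<rightarrow>\<^sub>M borel"
  proof -
    have "(\<lambda>(v, y). t v y) \<in> (count_space T \<Otimes>\<^sub>M borel) \<rightarrow>\<^sub>M borel"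
      using assms(1) t by (intro measurable_pair_measure_countable1) (auto intro: countable_finite)
    moreover have "sets P = sets (count_space T \<Otimes>\<^sub>M borel)"
      unfolding P_def U_def using assms(4)
      by (intro sets_pair_measure_cong) (simp_all add: sets_uniform_count_measure)
    ultimately show ?thesis
      by (simp cong: measurable_cong_sets)
  qed
  \<comment> \<open>Kept generic in the target type: real indicators will identify \<open>N\<close>
    with \<open>M\<close>, and then \<open>\<phi>\<close> gives the claim.\<close>
  have N: "(LINT x|N. \<psi> x) = (1 / real (card T)) *\<^sub>R (\<Sum>v\<in>T. LINT y|M. \<psi> (t v y))"
    if [measurable]: "\<psi> \<in> borel_measurable borel" and "\<And>x. norm (\<psi> x) \<le> C" for \<psi> :: "'b \<Rightarrow> 'd::{banach, second_countable_topology}" and C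
  proof -
    have "(LINT x|N. \<psi> x) = (LINT z|P. \<psi> (case z of (v, y) \<Rightarrow> t v y))"
      unfolding N_def by (intro integral_distr) measurable
    also have "\<dots> = (LINT v|U. LINT y|M. \<psi> (t v y))"
    proof -
      have "integrable P (\<lambda>z. \<psi> (case z of (v, y) \<Rightarrow> t v y))"
      proof (rule P'.integrable_const_bound)
        show "AE z in P. norm (\<psi> (case z of (v, y) \<Rightarrow> t v y)) \<le> C"
          using that(2) by simp
      qed measurable
      then show ?thesis
        unfolding P_def by (subst P.integral_fst'[symmetric]) auto
    qed
    also have "\<dots> = (\<Sum>v\<in>T. (1 / real (card T)) *\<^sub>R (LINT y|M. \<psi> (t v y)))"
      unfolding U_def uniform_count_measure_def
      using assms(1) by (subst lebesgue_integral_point_measure_finite) auto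
    finally show ?thesis by (simp add: scaleR_sum_right)
  qed
  have "N = M"
  proof (rule measure_eqI)
    show "sets N = sets M" unfolding N_def using assms(4) by simp
    fix Y assume "Y \<in> sets N"
    then have Y[measurable]: "Y \<in> sets borel" unfolding N_def by simp
    interpret N: finite_measure N
      unfolding N_def by (rule P'.finite_measure_distr) measurable
    have "measure N Y = (LINT x|N. indicator Y x)"
      by (simp add: N_def)
    also have "\<dots> = (1 / real (card T)) *\<^sub>R (\<Sum>v\<in>T. LINT y|M. indicator Y (t v y))"
      by (rule N[of _ 1]) (auto simp: indicator_def)
    also have "\<dots> = 1 / real (card T) * (\<Sum>v\<in>T. measure (distr M borel (t v)) Y)"
    proof -
      have "(LINT y|M. indicator Y (t v y)) = measure (distr M borel (t v)) Y" if "v \<in> T" for v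
      proof -
        have [measurable]: "t v \<in> M \<rightarrow>\<^sub>M borel"
          using t[OF that] assms(4) by (simp cong: measurable_cong_sets)
        have "measure (distr M borel (t v)) Y = (LINT y|distr M borel (t v). indicator Y y)"
          by simp
        also have "\<dots> = (LINT y|M. indicator Y (t v y))"
          by (rule integral_distr) measurable
        finally show ?thesis ..
      qed
      then show ?thesis by simp
    qed
    also have "\<dots> = measure M Y"
      using eq[OF Y] by simp
    finally show "emeasure N Y = emeasure M Y"
      by (simp add: N.emeasure_eq_measure M.emeasure_eq_measure)
  qed
  then show ?thesis
    using N[OF assms(7,8)] by simp
qed

lemma hutchinson_prob_on:
  assumes "hutchinson_measure \<Gamma> A \<Omega> s M" "\<Omega> \<in> sets borel"
  shows "prob_on \<Omega> M"
proof -
  have M: "sets M = sets borel" "emeasure M (- \<Omega>) = 0" "emeasure M \<Omega> = 1"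
    using assms(1) by (auto simp: hutchinson_measure_def)
  have "emeasure M (\<Omega> \<union> - \<Omega>) = emeasure M \<Omega> + emeasure M (- \<Omega>)"
    using assms(2) M(1) by (intro plus_emeasure[symmetric]) auto
  then show ?thesis
    using M by (simp add: prob_on_def)
qed

text \<open>All the maps share the linear part \<open>A\<close>. Integrating
  \<open>character k\<close> over the self-similarity, each translation contributes only a phase,
  the average of which is \<open>g_fun\<close>, and the linear part moves over to the frequency as
  its adjoint.\<close>

lemma hutchinson_fourier:
  assumes "hutchinson_measure \<Gamma> A \<Omega> s M" "\<Omega> \<in> sets borel" "linear A"
    and T: "finite (T_set \<Gamma> A \<Omega> s)" "T_set \<Gamma> A \<Omega> s \<noteq> {}"
  shows "fourier M k = g_fun \<Gamma> A \<Omega> s k * fourier M (adjoint A k)"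
proof -
  define T where "T = T_set \<Gamma> A \<Omega> s"
  have prob: "prob_on \<Omega> M"
    using hutchinson_prob_on assms(1,2) by blast
  have meas: "t_star \<Gamma> A v \<in> borel_measurable borel" for v
    unfolding t_star_def
    by (intro borel_measurable_continuous_onI continuous_intros linear_continuous_on linear_conv_bounded_linear[THEN iffD1] assms(3))
  have "fourier M k = (1 / real (card T)) *\<^sub>R (\<Sum>v\<in>T. LINT y|M. character k (t_star \<Gamma> A v y))"
    unfolding fourier_character
  proof (rule integral_uniform_mixture[where C=1])
    show "finite_measure M" "sets M = sets borel"
      using prob prob_on_finite[OF prob] by (auto simp: prob_on_def)
    show "measure M Y = 1 / real (card T) * (\<Sum>v\<in>T. measure (distr M borel (t_star \<Gamma> A v)) Y)" if "Y \<in> sets borel" for Y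
      using assms(1) that unfolding hutchinson_measure_def T_def by blast
  qed (use T meas in \<open>auto simp: T_def\<close>)
  also have "(\<Sum>v\<in>T. LINT y|M. character k (t_star \<Gamma> A v y)) = (\<Sum>v\<in>T. character k (star \<Gamma> v)) * fourier M (adjoint A k)"
    unfolding sum_distrib_right
    by (intro sum.cong refl)
      (simp add: t_star_def character_add_right character_adjoint[OF assms(3)] fourier_character mult.commute)
  finally show ?thesis
    by (simp add: g_fun_def T_def character_def scaleR_conv_of_real)
qed

section \<open>The invariant density\<close>

text \<open>Uniqueness of Haar measure replaces the determinant formula for the image of Lebesgue measure
  under \<open>B\<close>, which the library has only for well-ordered index types.\<close>

lemma integral_linear_proportional:
  fixes B :: "'a::euclidean_space \<Rightarrow> 'a" and h g :: "'a \<Rightarrow> complex"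
  assumes B: "linear B" "bij B"
    and h: "continuous_on UNIV h" "\<And>x. norm x > R \<Longrightarrow> h x = 0"
    and g: "continuous_on UNIV g" "\<And>x. norm x > R \<Longrightarrow> g x = 0"
  shows "(LINT x|lborel. h (B x)) * (LINT y|lborel. g y) = (LINT x|lborel. g (B x)) * (LINT y|lborel. h y)"
proof -
  have contB: "continuous_on S B" for S
    using B(1) by (intro linear_continuous_on linear_conv_bounded_linear[THEN iffD1])
  obtain c where c: "c > 0" "\<And>x. c * norm x \<le> norm (B x)"
    using linear_inj_bounded_below_pos[OF B(1)] B(2) by (metis bij_is_inj)
  \<comment> \<open>Integrate the convolution of \<open>h\<close> and \<open>g\<close> composed with
    \<open>B\<close>. For fixed \<open>y\<close> the shift by \<open>y\<close> is absorbed by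
    translating \<open>x\<close> by the preimage of \<open>y\<close> under \<open>B\<close>, so the
    double integral factorises. Exchanging \<open>h\<close> and \<open>g\<close> leaves the
    convolution unchanged, which gives the symmetry.\<close>
  have key: "(LINT x|lborel. h (B x)) * (LINT y|lborel. g y) = (LINT x|lborel. LINT y|lborel. h (B x - y) * g y)"
    if h: "continuous_on UNIV h" "\<And>x. norm x > R \<Longrightarrow> h x = 0"
    and g: "continuous_on UNIV g" "\<And>x. norm x > R \<Longrightarrow> g x = 0" for h g :: "'a \<Rightarrow> complex"
  proof -
    have meas: "(\<lambda>x. h (B x)) \<in> borel_measurable borel"
      by (intro borel_measurable_continuous_onI continuous_on_compose2[OF h(1) contB]) auto
    have shift: "(LINT x|lborel. h (B x - y)) = (LINT x|lborel. h (B x))" for y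
    proof -
      obtain z where z: "y = B z" using B(2) by (metis bij_pointE)
      show ?thesis
        using lborel_integral_translate[OF meas, of "- z"] z linear_diff[OF B(1)] by simp
    qed
    have "(LINT x|lborel. LINT y|lborel. h (B x - y) * g y) = (LINT y|lborel. LINT x|lborel. h (B x - y) * g y)"
    proof (rule Fubini_continuous)
      show "continuous_on UNIV (\<lambda>(x, y). h (B x - y) * g y)"
        unfolding case_prod_beta
        by (intro continuous_intros continuous_on_compose2[OF h(1)] continuous_on_compose2[OF g(1)] continuous_on_compose2[OF contB]) auto
      fix x y :: 'a assume *: "norm x > max \<bar>R\<bar> (2 * \<bar>R\<bar> / c) \<or> norm y > max \<bar>R\<bar> (2 * \<bar>R\<bar> / c)"
      show "h (B x - y) * g y = 0"
      proof (cases "norm y > R")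
        case False
        then have "norm x > 2 * \<bar>R\<bar> / c" using * by auto
        then have "2 * \<bar>R\<bar> < c * norm x" using c(1) by (simp add: pos_divide_less_eq mult.commute)
        then have "norm (B x - y) > R"
          using c(2)[of x] norm_triangle_ineq2[of "B x" y] False by linarith
        then show ?thesis using h(2) by simp
      qed (simp add: g(2))
    qed
    also have "\<dots> = (LINT x|lborel. h (B x)) * (LINT y|lborel. g y)"
      by (simp add: shift)
    finally show ?thesis ..
  qed
  have "(\<lambda>x. LINT y|lborel. h (B x - y) * g y) = (\<lambda>x. LINT y|lborel. g (B x - y) * h y)"
    by (intro ext convolution_commute h g)
  then show ?thesis
    using key[OF h g] key[OF g h] by simp
qed

definition window_transform :: "(real^'n) set \<Rightarrow> real^'n \<Rightarrow> complex" where
  "window_transform U k = (LINT u|lborel. indicator U u *\<^sub>R character k u) / of_real (measure lborel U)"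

context
  fixes A :: "real^'n \<Rightarrow> real^'n" and \<Omega> :: "(real^'n) set" and f :: "real^'n \<Rightarrow> real"
  assumes A: "linear A" "bij A" and \<Omega>: "compact \<Omega>" and U: "compact (Omega_Q A \<Omega>)"
    and f: "invariant_density A \<Omega> f"
begin

lemma density_in_C_space: "(\<lambda>x. complex_of_real (f x)) \<in> C_space \<Omega>"
  and density_nonneg: "f x \<ge> 0"
  and density_integral: "(LINT u|lborel. f u) = 1"
  and density_equation: "f x = 1 / (\<bar>det (matrix A)\<bar> * measure lborel (Omega_Q A \<Omega>)) *
                (LINT u:Omega_Q A \<Omega>|lborel. f (inv A (x - u)))"
  using f unfolding invariant_density_def by blast+

lemma density_continuous: "continuous_on UNIV f"
proof -
  have "continuous_on UNIV (\<lambda>x. Re (complex_of_real (f x)))"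
    using density_in_C_space unfolding C_space_def by (intro continuous_on_Re) blast
  then show ?thesis by simp
qed

lemma density_outside:
  assumes "x \<notin> \<Omega>"
  shows "f x = 0"
proof (rule ccontr)
  assume "f x \<noteq> 0"
  then have "x \<in> closure {x. complex_of_real (f x) \<noteq> 0}"
    by (intro subsetD[OF closure_subset]) simp
  then show False
    using density_in_C_space assms unfolding C_space_def by blast
qed

lemma density_vanishing: obtains R where "\<And>x. norm x > R \<Longrightarrow> f x = 0"
proof -
  obtain R where R: "\<forall>x\<in>\<Omega>. norm x \<le> R"
    using compact_imp_bounded[OF \<Omega>] unfolding bounded_iff by blast
  have "f x = 0" if "norm x > R" for x
    by (rule density_outside) (use R that in force)
  then show ?thesis using that by blast
qed

lemma density_integrable: "integrable lborel f"
proof -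
  obtain R where R: "\<And>x. norm x > R \<Longrightarrow> f x = 0" using density_vanishing by blast
  show ?thesis by (rule integrable_vanishing[OF density_continuous]) (rule R)
qed

lemma density_prob_on: "prob_on \<Omega> (density_measure f)"
proof -
  have [measurable]: "f \<in> borel_measurable borel"
    by (rule borel_measurable_continuous_onI[OF density_continuous])
  have "(\<integral>\<^sup>+x. ennreal (f x) \<partial>lborel) = ennreal (LINT x|lborel. f x)"
    by (intro nn_integral_eq_integral density_integrable) (simp add: density_nonneg)
  then have 1: "emeasure (density_measure f) UNIV = 1"
    unfolding density_measure_def by (simp add: emeasure_density density_integral)
  have 2: "emeasure (density_measure f) (- \<Omega>) = 0"
  proof -
    have "- \<Omega> \<in> sets borel" using compact_imp_closed[OF \<Omega>] by auto
    then have "emeasure (density_measure f) (- \<Omega>) = (\<integral>\<^sup>+x. ennreal (f x) * indicator (- \<Omega>) x \<partial>lborel)"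
      unfolding density_measure_def by (intro emeasure_density) auto
    also have "\<dots> = (\<integral>\<^sup>+x. 0 \<partial>(lborel :: (real^'n) measure))"
      by (intro nn_integral_cong) (auto simp: indicator_def density_outside)
    finally show ?thesis by simp
  qed
  show ?thesis using 1 2 by (simp add: prob_on_def density_measure_def)
qed

lemma density_fourier: "fourier (density_measure f) k = (LINT x|lborel. of_real (f x) * character k x)"
proof -
  have [measurable]: "f \<in> borel_measurable borel"
    by (rule borel_measurable_continuous_onI[OF density_continuous])
  have "fourier (density_measure f) k = (LINT x|lborel. f x *\<^sub>R character k x)"
    unfolding fourier_character density_measure_def
    by (intro integral_density) (simp_all add: density_nonneg)
  then show ?thesis by (simp add: scaleR_conv_of_real)
qed

text \<open>Transforming the invariance equation, Fubini and the shift by \<open>u\<close> split off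
  the window factor \<open>W k\<close> and leave \<open>J k\<close>, the transform of
  \<open>f\<close> composed with the inverse of \<open>A\<close>. By proportionality
  \<open>J k\<close> is the unknown constant \<open>J 0\<close> times the transform of
  \<open>f\<close> at \<open>adjoint A k\<close>; the case \<open>k = 0\<close> shows that
  \<open>J 0\<close> absorbs the determinant.\<close>

lemma density_fourier_scaling:
  "fourier (density_measure f) k = window_transform (Omega_Q A \<Omega>) k * fourier (density_measure f) (adjoint A k)"
proof -
  define B where "B = inv A"
  define V where "V = measure lborel (Omega_Q A \<Omega>)"
  define D where "D = \<bar>det (matrix A)\<bar> * V"
  define F where "F k = fourier (density_measure f) k" for k
  define W where "W k = (LINT u|lborel. indicator (Omega_Q A \<Omega>) u *\<^sub>R character k u)" for k
  define J where "J k = (LINT z|lborel. character k z * of_real (f (B z)))" for k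
  have B: "linear B" "bij B"
    unfolding B_def using A by (auto simp: bij_imp_bij_inv inj_linear_imp_inv_linear bij_is_inj)
  have AB: "A (B z) = z" for z
    unfolding B_def using A(2) by (simp add: bij_is_surj surj_f_inv_f)
  have contB: "continuous_on S B" for S
    using B(1) by (intro linear_continuous_on linear_conv_bounded_linear[THEN iffD1])
  have contA: "continuous_on S A" for S
    using A(1) by (intro linear_continuous_on linear_conv_bounded_linear[THEN iffD1])
  obtain R where R: "\<And>x. norm x > R \<Longrightarrow> f x = 0" using density_vanishing by blast
  obtain c where c: "c > 0" "\<And>x. c * norm x \<le> norm (B x)"
    using linear_inj_bounded_below_pos[OF B(1)] B(2) by (metis bij_is_inj)
  obtain R' where R': "\<And>x. x \<in> Omega_Q A \<Omega> \<Longrightarrow> norm x \<le> R'"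
    using compact_imp_bounded[OF U] unfolding bounded_iff by blast
  \<comment> \<open>Proportionality is applied to \<open>f\<close> and to \<open>f\<close> times
    \<open>character k\<close> composed with \<open>A\<close>; the former has integral 1, and
    \<open>A (B x) = x\<close> restores the plain character.\<close>
  have J: "J k = J 0 * F (adjoint A k)" for k
  proof -
    have "(LINT x|lborel. character k (A (B x)) * of_real (f (B x))) * (LINT y|lborel. complex_of_real (f y))
      = (LINT x|lborel. complex_of_real (f (B x))) * (LINT y|lborel. character k (A y) * of_real (f y))"
      by (rule integral_linear_proportional[OF B, where R=R])
         (auto intro!: continuous_intros density_continuous continuous_on_compose2[OF continuous_character contA] simp: R)
    moreover have "(LINT y|lborel. complex_of_real (f y)) = 1"
      by (simp add: density_integral)
    ultimately show ?thesis
      unfolding J_def F_def density_fourier AB character_adjoint[OF A(1)] by (simp add: mult.commute)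
  qed
  have F: "of_real D * F k = W k * J k" if "D \<noteq> 0" for k
  proof -
    \<comment> \<open>For \<open>u\<close> in \<open>Omega_Q\<close> and \<open>x\<close> outside
      this ball, \<open>f (B (x - u))\<close> vanishes. Inserting the indicator of \<open>S\<close>
      therefore changes nothing but makes the integrand compactly supported for Fubini.\<close>
    define S where "S = cball (0::real^'n) (\<bar>R'\<bar> + \<bar>R\<bar> / c)"
    have out: "f (B (x - u)) = 0" if "u \<in> Omega_Q A \<Omega>" "x \<notin> S" for x u
    proof -
      have "\<bar>R\<bar> / c < norm (x - u)"
        using R'[OF that(1)] that(2) norm_triangle_ineq2[of x u] unfolding S_def mem_cball_0 by linarith
      then have "\<bar>R\<bar> < c * norm (x - u)" using c(1) by (simp add: pos_divide_less_eq mult.commute)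
      then show ?thesis using c(2)[of "x - u"] R[of "B (x - u)"] by linarith
    qed
    have "complex_of_real D * of_real (f x) = of_real (LINT u|lborel. indicator (Omega_Q A \<Omega>) u * f (B (x - u)))" for x
    proof -
      have "f x = 1 / D * (LINT u|lborel. indicator (Omega_Q A \<Omega>) u * f (B (x - u)))"
        using density_equation[of x] unfolding D_def V_def B_def set_lebesgue_integral_def by simp
      then have "D * f x = (LINT u|lborel. indicator (Omega_Q A \<Omega>) u * f (B (x - u)))"
        using that by simp
      then show ?thesis by (metis of_real_mult)
    qed
    then have fx: "complex_of_real D * of_real (f x) = (LINT u|lborel. indicator (Omega_Q A \<Omega>) u *\<^sub>R of_real (f (B (x - u))))" for x
      unfolding integral_complex_of_real[symmetric]
      by (simp add: scaleR_conv_of_real)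
    have "of_real D * F k = (LINT x|lborel. of_real D * (of_real (f x) * character k x))"
      unfolding F_def density_fourier by simp
    also have "\<dots> = (LINT x|lborel. LINT u|lborel. indicator S x *\<^sub>R indicator (Omega_Q A \<Omega>) u *\<^sub>R (of_real (f (B (x - u))) * character k x))"
    proof (rule Bochner_Integration.integral_cong[OF refl])
      fix x
      have "of_real D * (of_real (f x) * character k x) = (of_real D * of_real (f x)) * character k x"
        by simp
      also have "\<dots> = (LINT u|lborel. (indicator (Omega_Q A \<Omega>) u *\<^sub>R of_real (f (B (x - u)))) * character k x)"
        unfolding fx by (rule integral_mult_left_zero[symmetric])
      also have "\<dots> = (LINT u|lborel. indicator S x *\<^sub>R indicator (Omega_Q A \<Omega>) u *\<^sub>R (of_real (f (B (x - u))) * character k x))"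
        using out[of _ x] by (intro Bochner_Integration.integral_cong[OF refl]) (auto simp: indicator_def)
      finally show "of_real D * (of_real (f x) * character k x) = \<dots>" .
    qed
    also have "\<dots> = (LINT u|lborel. LINT x|lborel. indicator S x *\<^sub>R indicator (Omega_Q A \<Omega>) u *\<^sub>R (of_real (f (B (x - u))) * character k x))"
    proof (rule Fubini_compact[OF _ _ U])
      show "continuous_on UNIV (\<lambda>(x, u). complex_of_real (f (B (x - u))) * character k x)"
        unfolding case_prod_beta
        by (intro continuous_intros continuous_on_compose2[OF density_continuous] continuous_on_compose2[OF contB]
            continuous_on_compose2[OF continuous_character]) auto
    qed (simp add: S_def)
    also have "\<dots> = (LINT u|lborel. (indicator (Omega_Q A \<Omega>) u *\<^sub>R character k u) * J k)"
    proof (rule Bochner_Integration.integral_cong[OF refl])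
      fix u
      show "(LINT x|lborel. indicator S x *\<^sub>R indicator (Omega_Q A \<Omega>) u *\<^sub>R (of_real (f (B (x - u))) * character k x))
        = (indicator (Omega_Q A \<Omega>) u *\<^sub>R character k u) * J k"
      proof (cases "u \<in> Omega_Q A \<Omega>")
        case True
        have "(\<lambda>x. complex_of_real (f (B (x - u))) * character k x) \<in> borel_measurable borel"
          by (intro borel_measurable_continuous_onI continuous_intros continuous_on_compose2[OF density_continuous]
            continuous_on_compose2[OF contB] continuous_character) auto
        from lborel_integral_translate[OF this, of u]
        have "(LINT x|lborel. of_real (f (B (x - u))) * character k x) = (LINT z|lborel. character k u * (character k z * of_real (f (B z))))"
          by (simp add: character_add_right mult_ac)
        also have "\<dots> = character k u * J k" unfolding J_def by simp
        also have "(LINT x|lborel. of_real (f (B (x - u))) * character k x) = (LINT x|lborel. indicator S x *\<^sub>R indicator (Omega_Q A \<Omega>) u *\<^sub>R (of_real (f (B (x - u))) * character k x))"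
          using out[OF True] True by (intro Bochner_Integration.integral_cong[OF refl]) (auto simp: indicator_def)
        finally show ?thesis using True by simp
      qed simp
    qed
    also have "\<dots> = W k * J k" unfolding W_def by (rule integral_mult_left_zero)
    finally show ?thesis .
  qed
  have "prob_on \<Omega> (density_measure f)" by (rule density_prob_on)
  then have F0: "F 0 = 1" unfolding F_def by (rule fourier_0)
  \<comment> \<open>Division by zero gives 0, so \<open>D = 0\<close> would turn the invariance
    equation into \<open>f = 0\<close>, against integral 1.\<close>
  have D: "D \<noteq> 0"
  proof
    assume "D = 0"
    then have "f x = 0" for x
      using density_equation[of x] unfolding D_def V_def by simp
    then have "(LINT x|lborel. f x) = 0" by simp
    then show False using density_integral by simp
  qed
  have W0: "W 0 = of_real V"
  proof -
    have "integrable lborel (indicator (Omega_Q A \<Omega>) :: _ \<Rightarrow> real)"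
      using fmeasurable_compact[OF U] by (intro integrable_real_indicator) (auto simp: fmeasurable_def)
    then have "W 0 = (LINT u|lborel. indicator (Omega_Q A \<Omega>) u) *\<^sub>R 1"
      unfolding W_def character_0 by (intro integral_scaleR_left)
    then show ?thesis unfolding V_def by (simp add: scaleR_conv_of_real)
  qed
  have "complex_of_real D = of_real V * J 0"
    using F[OF D, of 0] F0 W0 by simp
  moreover have "V \<noteq> 0" using D unfolding D_def by auto
  ultimately have "F k = W k / of_real V * F (adjoint A k)"
    using F[OF D, of k] D J[of k] by (auto simp: field_simps)
  then show ?thesis
    unfolding F_def W_def V_def window_transform_def .
qed

end

section \<open>Powers of the internal map\<close>

lemma linear_power_adjoint:
  fixes A :: "'a::euclidean_space \<Rightarrow> 'a"
  assumes "linear A"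
  shows "x \<bullet> (adjoint A ^^ N) k = (A ^^ N) x \<bullet> k"
proof (induction N arbitrary: x)
  case (Suc N)
  have "x \<bullet> (adjoint A ^^ Suc N) k = A x \<bullet> (adjoint A ^^ N) k"
    using adjoint_works[OF assms, of x "(adjoint A ^^ N) k"] by simp
  also have "\<dots> = (A ^^ Suc N) x \<bullet> k"
    by (simp add: Suc.IH funpow_swap1)
  finally show ?case .
qed simp

definition complex_vector :: "real^'n \<Rightarrow> complex^'n" where
  "complex_vector x = (\<chi> i. complex_of_real (x $ i))"

lemma complex_vector_apply:
  assumes "linear A"
  shows "complex_vector (A x) = complex_matrix A *v complex_vector x"
proof -
  have "A x = matrix A *v x" using assms by (simp add: matrix_works)
  then show ?thesis
    by (simp add: vec_eq_iff complex_vector_def complex_matrix_def matrix_vector_mult_def)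
qed

text \<open>In an eigenbasis the coordinates of the powers of \<open>A\<close> applied to
  \<open>x\<close> are multiples of powers of the diagonal entries, so each real coordinate is
  dominated by a finite sum of geometric series. Summability is what the infinite product needs, and
  \<open>A\<close> need not contract the Euclidean norm.\<close>

lemma power_summable:
  fixes A :: "real^'n \<Rightarrow> real^'n"
  assumes A: "linear A" and diag: "complex_diagonalizable A"
    and eig: "\<And>c. complex_eigenvalue A c \<Longrightarrow> cmod c < 1"
  shows "summable (\<lambda>N. \<bar>(A ^^ N) x $ j\<bar>)"
proof -
  obtain P D :: "complex^'n^'n" where P: "invertible P" and D: "\<And>i j. i \<noteq> j \<Longrightarrow> D $ i $ j = 0"
    and PD: "complex_matrix A = P ** D ** matrix_inv P"
    using diag unfolding complex_diagonalizable_def by blast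
  have inv: "matrix_inv P ** P = mat 1" "P ** matrix_inv P = mat 1"
    using someI_ex[OF P[unfolded invertible_def]] by (simp_all add: matrix_inv_def)
  have Dv: "D *v u = (\<chi> i. D $ i $ i * u $ i)" for u
  proof -
    have "(\<Sum>j\<in>UNIV. D $ i $ j * u $ j) = D $ i $ i * u $ i" for i
      using D[of i] by (subst sum.remove[of _ i]) (auto intro!: sum.neutral)
    then show ?thesis by (simp add: matrix_vector_mult_def)
  qed
  have step: "complex_matrix A *v (P *v u) = P *v (\<chi> i. D $ i $ i * u $ i)" for u
    unfolding PD Dv[symmetric]
    by (metis inv(1) matrix_vector_mul_assoc matrix_vector_mul_lid)
  have small: "cmod (D $ i $ i) < 1" for i
  proof (rule eig)
    \<comment> \<open>The \<open>i\<close>-th column of \<open>P\<close>: nonzero because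
      \<open>P\<close> is invertible, and an eigenvector for the \<open>i\<close>-th diagonal
      entry.\<close>
    define v where "v = P *v axis i 1"
    have "axis i 1 = matrix_inv P *v v"
      unfolding v_def by (simp add: matrix_vector_mul_assoc inv(1))
    then have "v \<noteq> 0"
      by (metis axis_eq_0_iff matrix_vector_mult_0_right zero_neq_one)
    moreover have "complex_matrix A *v v = P *v (D $ i $ i *s axis i 1)"
      unfolding v_def step by (rule arg_cong[where f="\<lambda>u. P *v u"]) (auto simp: vec_eq_iff axis_def)
    then have "complex_matrix A *v v = D $ i $ i *s v"
      unfolding v_def by (simp add: matrix_vector_mult_scaleR vector_scalar_commute)
    ultimately show "complex_eigenvalue A (D $ i $ i)"
      unfolding complex_eigenvalue_def by blast
  qed
  define w where "w = matrix_inv P *v complex_vector x"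
  have pow: "complex_vector ((A ^^ N) x) = P *v (\<chi> i. (D $ i $ i) ^ N * w $ i)" for N
  proof (induction N)
    case 0
    show ?case by (simp add: w_def matrix_vector_mul_assoc inv(2))
  next
    case (Suc N)
    then show ?case
      by (simp add: complex_vector_apply[OF A] step mult.assoc)
  qed
  have "summable (\<lambda>N. \<Sum>i\<in>UNIV. cmod (P $ j $ i) * cmod (w $ i) * cmod (D $ i $ i) ^ N)"
    using small by (intro summable_sum summable_mult summable_geometric) simp
  then show ?thesis
  proof (rule summable_comparison_test')
    fix N :: nat
    have "\<bar>(A ^^ N) x $ j\<bar> = cmod (complex_vector ((A ^^ N) x) $ j)"
      by (simp add: complex_vector_def)
    also have "\<dots> = cmod (\<Sum>i\<in>UNIV. P $ j $ i * ((D $ i $ i) ^ N * w $ i))"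
      unfolding pow by (simp add: matrix_vector_mult_def)
    also have "\<dots> \<le> (\<Sum>i\<in>UNIV. cmod (P $ j $ i * ((D $ i $ i) ^ N * w $ i)))"
      by (rule norm_sum)
    also have "\<dots> = (\<Sum>i\<in>UNIV. cmod (P $ j $ i) * cmod (w $ i) * cmod (D $ i $ i) ^ N)"
      by (simp add: norm_mult norm_power mult_ac)
    finally show "norm \<bar>(A ^^ N) x $ j\<bar> \<le> (\<Sum>i\<in>UNIV. cmod (P $ j $ i) * cmod (w $ i) * cmod (D $ i $ i) ^ N)"
      by simp
  qed
qed

text \<open>The spectral assumptions concern \<open>A\<close>, the product the adjoint. The
  \<open>i\<close>-th coordinate of the adjoint power at \<open>k\<close> is the inner product of
  \<open>k\<close> with the power of \<open>A\<close> at the \<open>i\<close>-th unit vector, which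
  reduces the claim to \<open>power_summable\<close>.\<close>

lemma adjoint_power_summable:
  fixes A :: "real^'n \<Rightarrow> real^'n"
  assumes "linear A" "complex_diagonalizable A" "\<And>c. complex_eigenvalue A c \<Longrightarrow> cmod c < 1"
  shows "summable (\<lambda>N. norm ((adjoint A ^^ N) k))"
proof -
  have "summable (\<lambda>N. \<Sum>i\<in>UNIV. \<Sum>j\<in>UNIV. \<bar>(A ^^ N) (axis i 1) $ j\<bar> * \<bar>k $ j\<bar>)"
    by (intro summable_sum summable_mult2 power_summable assms)
  then show ?thesis
  proof (rule summable_comparison_test')
    fix N :: nat
    have "norm ((adjoint A ^^ N) k) \<le> (\<Sum>i\<in>UNIV. \<bar>(adjoint A ^^ N) k $ i\<bar>)"
      by (rule norm_le_l1_cart)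
    also have "\<dots> \<le> (\<Sum>i\<in>UNIV. \<Sum>j\<in>UNIV. \<bar>(A ^^ N) (axis i 1) $ j\<bar> * \<bar>k $ j\<bar>)"
    proof (rule sum_mono)
      fix i :: 'n
      have "(adjoint A ^^ N) k $ i = (A ^^ N) (axis i 1) \<bullet> k"
        using linear_power_adjoint[OF assms(1), of "axis i 1" N k] by (simp add: inner_axis')
      also have "\<dots> = (\<Sum>j\<in>UNIV. (A ^^ N) (axis i 1) $ j * k $ j)"
        by (simp add: inner_vec_def)
      finally show "\<bar>(adjoint A ^^ N) k $ i\<bar> \<le> (\<Sum>j\<in>UNIV. \<bar>(A ^^ N) (axis i 1) $ j\<bar> * \<bar>k $ j\<bar>)"
        using sum_abs[of "\<lambda>j. (A ^^ N) (axis i 1) $ j * k $ j" UNIV] by (simp add: abs_mult)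
    qed
    finally show "norm (norm ((adjoint A ^^ N) k)) \<le> (\<Sum>i\<in>UNIV. \<Sum>j\<in>UNIV. \<bar>(A ^^ N) (axis i 1) $ j\<bar> * \<bar>k $ j\<bar>)"
      by simp
  qed
qed

section \<open>The translation window\<close>

text \<open>An intersection of translates of \<open>\<Omega>\<close> by the vectors
  \<open>- A y\<close>. Non-emptiness of \<open>\<Omega>\<close> provides one compact set in the
  intersection.\<close>

lemma compact_Omega_Q:
  assumes "compact \<Omega>" "\<Omega> \<noteq> {}"
  shows "compact (Omega_Q A \<Omega>)"
proof -
  define K where "K y = (\<lambda>z. z - A y) ` \<Omega>" for y
  have "A y + u \<in> \<Omega> \<longleftrightarrow> u \<in> K y" for y u
    by (auto simp: K_def image_iff algebra_simps)
  then have eq: "Omega_Q A \<Omega> = (\<Inter>y\<in>\<Omega>. K y)"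
    by (auto simp: Omega_Q_def)
  have K: "compact (K y)" for y
    unfolding K_def using assms(1) by (intro compact_continuous_image continuous_intros)
  obtain y where "y \<in> \<Omega>" using assms(2) by blast
  then have "Omega_Q A \<Omega> = K y \<inter> (\<Inter>y\<in>\<Omega>. K y)"
    unfolding eq by blast
  moreover have "closed (\<Inter>y\<in>\<Omega>. K y)"
    by (intro closed_INT ballI compact_imp_closed K)
  ultimately show ?thesis
    using compact_Int_closed[OF K] by metis
qed

lemma star_fst:
  assumes "inj_on fst \<Gamma>" "\<gamma> \<in> \<Gamma>"
  shows "star \<Gamma> (fst \<gamma>) = snd \<gamma>"
  using assms by (simp add: star_def the_inv_into_f_f)

lemma T_set_eq:
  assumes "inj_on fst \<Gamma>"
  shows "T_set \<Gamma> A \<Omega> s = fst ` {\<gamma> \<in> \<Gamma>. norm (fst \<gamma>) \<le> s \<and> snd \<gamma> \<in> Omega_Q A \<Omega>}"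
  unfolding T_set_def Lam_def phys_def using star_fst[OF assms] by force

lemma sum_T_set:
  assumes "inj_on fst \<Gamma>"
  shows "(\<Sum>v\<in>T_set \<Gamma> A \<Omega> s. F (star \<Gamma> v)) = (\<Sum>\<gamma> | \<gamma> \<in> \<Gamma> \<and> norm (fst \<gamma>) \<le> s \<and> snd \<gamma> \<in> Omega_Q A \<Omega>. F (snd \<gamma>))"
proof -
  have "inj_on fst {\<gamma> \<in> \<Gamma>. norm (fst \<gamma>) \<le> s \<and> snd \<gamma> \<in> Omega_Q A \<Omega>}"
    by (rule inj_on_subset[OF assms]) auto
  then show ?thesis
    unfolding T_set_eq[OF assms] by (simp add: sum.reindex star_fst[OF assms])
qed

section \<open>The index sets \<open>T_s\<close> of a cut and project scheme\<close>

context
  fixes \<Gamma> :: "((real^'m) \<times> (real^'n)) set"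
  assumes cp: "cut_and_project \<Gamma>"
begin

interpretation cut_and_project_lattice \<Gamma>
  using cp by unfold_locales (auto simp: cut_and_project_def)

lemma inj_fst: "inj_on fst \<Gamma>"
  using cp by (simp add: cut_and_project_def)

text \<open>Since \<open>Q\<close> maps onto \<open>phys \<Gamma>\<close>, every star image lies in
  the range of \<open>A\<close>. That range is a subspace, hence closed, and it contains a dense
  set; a surjective linear endomorphism in finite dimension is bijective.\<close>

lemma bij_internal_map:
  assumes "internal_map \<Gamma> Q A" "Q ` phys \<Gamma> = phys \<Gamma>"
  shows "bij A"
proof -
  have A: "linear A" using assms(1) by (simp add: internal_map_def)
  have "snd ` \<Gamma> \<subseteq> range A"
  proof
    fix y assume "y \<in> snd ` \<Gamma>"
    then obtain \<gamma> where \<gamma>: "\<gamma> \<in> \<Gamma>" "y = snd \<gamma>" by blast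
    then have "fst \<gamma> \<in> Q ` phys \<Gamma>" unfolding assms(2) by (auto simp: phys_def)
    then obtain x where "x \<in> phys \<Gamma>" "fst \<gamma> = Q x" by blast
    then have "y = A (star \<Gamma> x)"
      using assms(1) \<gamma> star_fst[OF inj_fst \<gamma>(1)] by (simp add: internal_map_def)
    then show "y \<in> range A" by blast
  qed
  moreover have "closed (range A)"
    using A by (intro closed_subspace linear_subspace_image subspace_UNIV)
  ultimately have "range A = UNIV"
    using dense closure_minimal by blast
  then show ?thesis
    using A linear_surjective_imp_injective[of A] by (auto simp: bij_def)
qed

lemma finite_T_set:
  assumes "compact (Omega_Q A \<Omega>)"
  shows "finite (T_set \<Gamma> A \<Omega> s)"
proof -
  obtain B where B: "\<forall>x\<in>Omega_Q A \<Omega>. norm x \<le> B"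
    using compact_imp_bounded[OF assms] unfolding bounded_iff by blast
  have "{\<gamma> \<in> \<Gamma>. norm (fst \<gamma>) \<le> s \<and> snd \<gamma> \<in> Omega_Q A \<Omega>} \<subseteq> cylinder \<Gamma> s B"
    using B by (auto simp: cylinder_def)
  then show ?thesis
    unfolding T_set_eq[OF inj_fst] by (intro finite_imageI finite_subset[OF _ finite_cylinder])
qed

lemma zero_in_T_set:
  assumes "A ` \<Omega> \<subseteq> \<Omega>" "s > 0"
  shows "0 \<in> T_set \<Gamma> A \<Omega> s"
proof -
  have "(0 :: (real^'m) \<times> (real^'n)) \<in> {\<gamma> \<in> \<Gamma>. norm (fst \<gamma>) \<le> s \<and> snd \<gamma> \<in> Omega_Q A \<Omega>}"
    using assms lattice_zero[OF lattice] by (auto simp: Omega_Q_def)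
  then show ?thesis
    unfolding T_set_eq[OF inj_fst] by (rule image_eqI[rotated]) simp
qed

lemma T_set_average:
  fixes \<phi> :: "real^'n \<Rightarrow> real"
  assumes U: "compact (Omega_Q A \<Omega>)" "interior (Omega_Q A \<Omega>) \<noteq> {}" "frontier (Omega_Q A \<Omega>) \<in> null_sets lborel"
    and \<phi>: "continuous_on UNIV \<phi>"
  shows "((\<lambda>s. (\<Sum>v\<in>T_set \<Gamma> A \<Omega> s. \<phi> (star \<Gamma> v)) / real (card (T_set \<Gamma> A \<Omega> s)))
    \<longlongrightarrow> (LINT u|lborel. indicator (Omega_Q A \<Omega>) u * \<phi> u) / measure lborel (Omega_Q A \<Omega>)) at_top"
proof -
  have "layer_sum \<Gamma> (\<lambda>x. indicator (Omega_Q A \<Omega>) x * g x) s = (\<Sum>v\<in>T_set \<Gamma> A \<Omega> s. g (star \<Gamma> v))" for g s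
  proof -
    obtain B where B: "\<forall>x\<in>Omega_Q A \<Omega>. norm x \<le> B"
      using compact_imp_bounded[OF U(1)] unfolding bounded_iff by blast
    have "layer_sum \<Gamma> (\<lambda>x. indicator (Omega_Q A \<Omega>) x * g x) s = (\<Sum>\<gamma>\<in>cylinder \<Gamma> s B. indicator (Omega_Q A \<Omega>) (snd \<gamma>) * g (snd \<gamma>))"
      by (rule layer_sum_eq) (use B in \<open>force simp: indicator_def\<close>)
    also have "\<dots> = (\<Sum>\<gamma> | \<gamma> \<in> \<Gamma> \<and> norm (fst \<gamma>) \<le> s \<and> snd \<gamma> \<in> Omega_Q A \<Omega>. g (snd \<gamma>))"
      using B by (intro sum.mono_neutral_cong_right finite_cylinder) (auto simp: cylinder_def indicator_def)
    finally show ?thesis by (simp only: sum_T_set[OF inj_fst])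
  qed
  note eq = this
  have "layer_sum \<Gamma> (indicator (Omega_Q A \<Omega>)) s = real (card (T_set \<Gamma> A \<Omega> s))" for s
    using eq[of "\<lambda>_. 1" s] by simp
  then show ?thesis
    using layer_sum_window[OF U \<phi>] by (simp add: eq)
qed

lemma g_fun_tendsto:
  assumes U: "compact (Omega_Q A \<Omega>)" "interior (Omega_Q A \<Omega>) \<noteq> {}" "frontier (Omega_Q A \<Omega>) \<in> null_sets lborel"
  shows "((\<lambda>s. g_fun \<Gamma> A \<Omega> s k) \<longlongrightarrow> window_transform (Omega_Q A \<Omega>) k) at_top"
proof -
  define V where "V = measure lborel (Omega_Q A \<Omega>)"
  have g: "g_fun \<Gamma> A \<Omega> s k = (\<Sum>v\<in>T_set \<Gamma> A \<Omega> s. character k (star \<Gamma> v)) / of_real (real (card (T_set \<Gamma> A \<Omega> s)))" for s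
    by (simp add: g_fun_def character_def)
  have int: "integrable lborel (\<lambda>u. indicator (Omega_Q A \<Omega>) u *\<^sub>R character k u)"
    by (intro borel_integrable_compact U(1) continuous_character)
  have "((\<lambda>s. Re (g_fun \<Gamma> A \<Omega> s k)) \<longlongrightarrow> Re (window_transform (Omega_Q A \<Omega>) k)) at_top"
    using T_set_average[OF U, of "\<lambda>x. Re (character k x)"] integral_Re[OF int]
    by (simp add: g window_transform_def Re_divide_of_real continuous_on_Re continuous_character)
  moreover have "((\<lambda>s. Im (g_fun \<Gamma> A \<Omega> s k)) \<longlongrightarrow> Im (window_transform (Omega_Q A \<Omega>) k)) at_top"
    using T_set_average[OF U, of "\<lambda>x. Im (character k x)"] integral_Im[OF int]
    by (simp add: g window_transform_def Im_divide_of_real continuous_on_Im continuous_character)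
  ultimately show ?thesis
    by (simp add: tendsto_complex_iff)
qed

end

lemma norm_g_fun_le: "norm (g_fun \<Gamma> A \<Omega> s k) \<le> 1"
proof -
  have "norm (\<Sum>v\<in>T_set \<Gamma> A \<Omega> s. character k (star \<Gamma> v)) \<le> real (card (T_set \<Gamma> A \<Omega> s)) * 1"
    by (rule sum_norm_bound) simp
  then show ?thesis
    unfolding g_fun_def character_def[symmetric]
    by (auto simp: norm_mult norm_divide divide_le_eq_1)
qed

lemma norm_g_fun_minus_1_le:
  assumes "finite (T_set \<Gamma> A \<Omega> s)" "T_set \<Gamma> A \<Omega> s \<noteq> {}" "\<And>v. v \<in> T_set \<Gamma> A \<Omega> s \<Longrightarrow> norm (star \<Gamma> v) \<le> R"
  shows "norm (g_fun \<Gamma> A \<Omega> s k - 1) \<le> 2 * pi * R * norm k"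
proof -
  define T where "T = T_set \<Gamma> A \<Omega> s"
  have T: "card T > 0" unfolding T_def using assms(1,2) by (simp add: card_gt_0_iff)
  have "g_fun \<Gamma> A \<Omega> s k - 1 = (\<Sum>v\<in>T. character k (star \<Gamma> v) - 1) / of_nat (card T)"
    using T by (simp add: g_fun_def T_def character_def sum_subtractf diff_divide_distrib)
  also have "norm \<dots> = norm (\<Sum>v\<in>T. character k (star \<Gamma> v) - 1) / real (card T)"
    by (simp add: norm_divide)
  also have "\<dots> \<le> (real (card T) * (2 * pi * R * norm k)) / real (card T)"
  proof (intro divide_right_mono sum_norm_bound)
    fix v assume "v \<in> T"
    have "norm (character k (star \<Gamma> v) - 1) \<le> 2 * pi * norm k * norm (star \<Gamma> v)"
      by (rule character_minus_1_le)
    also have "\<dots> \<le> 2 * pi * norm k * R"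
      using \<open>v \<in> T\<close> unfolding T_def by (intro mult_left_mono assms(3)) auto
    finally show "norm (character k (star \<Gamma> v) - 1) \<le> 2 * pi * R * norm k"
      by (simp only: mult_ac)
  qed simp
  also have "\<dots> = 2 * pi * R * norm k" using T by simp
  finally show ?thesis .
qed

section \<open>From Fourier transforms to infinite products and weak convergence\<close>

lemma refinement_product:
  fixes F g :: "'a \<Rightarrow> complex"
  assumes "\<And>k. F k = g k * F (B k)"
  shows "F k = (\<Prod>N<M. g ((B ^^ N) k)) * F ((B ^^ M) k)"
proof (induction M)
  case (Suc M)
  have "F ((B ^^ M) k) = g ((B ^^ M) k) * F ((B ^^ Suc M) k)"
    using assms[of "(B ^^ M) k"] by simp
  with Suc show ?case by simp
qed simp

text \<open>The relation \<open>has_prod\<close> demands more than convergence of partial products: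
  after finitely many zero factors the tail must have a nonzero limit. Absolute summability of
  \<open>g - 1\<close> along the orbit supplies this, and the remainder
  \<open>F ((B ^^ M) k)\<close>, which tends to 1, identifies the value.\<close>

lemma refinement_has_prod:
  fixes F g :: "'a::real_normed_vector \<Rightarrow> complex"
  assumes "\<And>k. F k = g k * F (B k)"
    and g: "\<And>k. norm (g k - 1) \<le> L * norm k" and F: "\<And>k. norm (F k - 1) \<le> L * norm k"
    and sum: "summable (\<lambda>N. norm ((B ^^ N) k))"
  shows "(\<lambda>N. g ((B ^^ N) k)) has_prod F k"
proof -
  have "summable (\<lambda>N. norm (g ((B ^^ N) k) - 1))"
    by (rule summable_comparison_test'[OF summable_mult[OF sum, of L]]) (simp add: g)
  then have conv: "convergent_prod (\<lambda>N. g ((B ^^ N) k))"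
    by (intro abs_convergent_prod_imp_convergent_prod) (simp add: abs_convergent_prod_conv_summable)
  define P where "P = prodinf (\<lambda>N. g ((B ^^ N) k))"
  have P: "(\<lambda>N. g ((B ^^ N) k)) has_prod P"
    unfolding P_def using conv by (rule convergent_prod_has_prod)
  have "(\<lambda>M. norm ((B ^^ M) k)) \<longlonglongrightarrow> 0"
    using sum by (rule summable_LIMSEQ_zero)
  then have "(\<lambda>M. L * norm ((B ^^ M) k)) \<longlonglongrightarrow> 0"
    by (rule tendsto_mult_right_zero)
  then have "(\<lambda>M. F ((B ^^ M) k) - 1) \<longlonglongrightarrow> 0"
    by (rule Lim_null_comparison[rotated]) (simp add: F)
  then have "(\<lambda>M. F ((B ^^ M) k)) \<longlonglongrightarrow> 1"
    by (simp add: LIM_zero_iff)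
  with has_prod_imp_tendsto'[OF P] have "(\<lambda>M. (\<Prod>N<M. g ((B ^^ N) k)) * F ((B ^^ M) k)) \<longlonglongrightarrow> P * 1"
    by (rule tendsto_mult)
  then have "(\<lambda>M. F k) \<longlonglongrightarrow> P"
    by (simp add: refinement_product[where F=F and g=g and B=B, OF assms(1), symmetric])
  then have "F k = P" by (rule LIMSEQ_unique[OF tendsto_const])
  with P show ?thesis by simp
qed

text \<open>All partial products are bounded by 1, so replacing the remainder by 1 costs at most
  \<open>L * norm ((B ^^ M) k)\<close>. Thus \<open>M\<close> can be chosen independently of
  \<open>s\<close>, after which only finitely many factors have to converge.\<close>

lemma refinement_tendsto:
  fixes F g :: "'s \<Rightarrow> 'a::real_normed_vector \<Rightarrow> complex"
  assumes F: "\<And>s k. F s k = g s k * F s (B k)" "\<And>s k. norm (F s k - 1) \<le> L * norm k"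
    and g: "\<And>s k. norm (g s k) \<le> 1" "\<And>k. ((\<lambda>s. g s k) \<longlongrightarrow> g' k) \<FF>"
    and F': "\<And>k. F' k = g' k * F' (B k)" "\<And>k. norm (F' k - 1) \<le> L * norm k"
    and nontriv: "\<FF> \<noteq> bot"
    and lim: "(\<lambda>N. norm ((B ^^ N) k)) \<longlonglongrightarrow> 0"
  shows "((\<lambda>s. F s k) \<longlongrightarrow> F' k) \<FF>"
proof (rule tendstoI)
  fix e :: real assume e: "e > 0"
  have g': "norm (g' k) \<le> 1" for k
    by (rule tendsto_upperbound[OF tendsto_norm[OF g(2)[of k]]]) (simp_all add: g(1) nontriv)
  have "(\<lambda>M. L * norm ((B ^^ M) k)) \<longlonglongrightarrow> 0"
    using lim by (rule tendsto_mult_right_zero)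
  then have "\<forall>\<^sub>F M in sequentially. L * norm ((B ^^ M) k) < e / 3"
    using e by (intro order_tendstoD) auto
  then obtain M where M: "L * norm ((B ^^ M) k) < e / 3"
    by (auto simp: eventually_sequentially)
  define P where "P s = (\<Prod>N<M. g s ((B ^^ N) k))" for s
  define P' where "P' = (\<Prod>N<M. g' ((B ^^ N) k))"
  have bound: "norm (p * x - p) \<le> norm (x - 1)" if "norm p \<le> 1" for p x :: complex
  proof -
    have "p * x - p = p * (x - 1)" by (simp add: algebra_simps)
    then show ?thesis using that by (simp add: norm_mult mult_left_le_one_le)
  qed
  have 1: "norm (F s k - P s) < e / 3" for s
  proof -
    have "norm (P s) \<le> 1"
      unfolding P_def prod_norm[symmetric] by (intro prod_le_1) (simp add: g(1))
    then have "norm (F s k - P s) \<le> norm (F s ((B ^^ M) k) - 1)"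
      using bound refinement_product[where F="F s" and g="g s" and B=B and k=k and M=M] F(1) unfolding P_def by metis
    also have "\<dots> \<le> L * norm ((B ^^ M) k)" by (rule F(2))
    finally show ?thesis using M by simp
  qed
  have 2: "norm (F' k - P') < e / 3"
  proof -
    have "norm P' \<le> 1"
      unfolding P'_def prod_norm[symmetric] by (intro prod_le_1) (simp add: g')
    then have "norm (F' k - P') \<le> norm (F' ((B ^^ M) k) - 1)"
      using bound refinement_product[where F=F' and g=g' and B=B and k=k and M=M] F'(1) unfolding P'_def by metis
    also have "\<dots> \<le> L * norm ((B ^^ M) k)" by (rule F'(2))
    finally show ?thesis using M by simp
  qed
  have "(P \<longlongrightarrow> P') \<FF>"
    unfolding P_def P'_def by (intro tendsto_prod g(2))
  then have "\<forall>\<^sub>F s in \<FF>. dist (P s) P' < e / 3"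
    using e by (intro tendstoD) auto
  then show "\<forall>\<^sub>F s in \<FF>. dist (F s k) (F' k) < e"
  proof eventually_elim
    case (elim s)
    have "dist (F s k) (F' k) \<le> dist (F s k) (P s) + dist (P s) P' + dist P' (F' k)"
      by (metis dist_triangle add.assoc add_left_mono order_trans)
    also have "\<dots> < e"
      using 1[of s] 2 elim by (simp add: dist_norm norm_minus_commute)
    finally show ?case .
  qed
qed

text \<open>Convergence at the finitely many centres of a \<open>d\<close>-net of \<open>K\<close>
  spreads to all of \<open>K\<close>, since moving to the nearest centre changes both sides by less
  than \<open>e / 3\<close>.\<close>

lemma uniform_limit_Lipschitz:
  fixes F :: "'s \<Rightarrow> 'a::metric_space \<Rightarrow> 'b::metric_space"
  assumes "compact K" "\<And>k. ((\<lambda>s. F s k) \<longlongrightarrow> F' k) \<FF>" "L \<ge> 0"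
    and F: "\<And>s k l. dist (F s k) (F s l) \<le> L * dist k l" and F': "\<And>k l. dist (F' k) (F' l) \<le> L * dist k l"
  shows "uniform_limit K F F' \<FF>"
proof (rule uniform_limitI)
  fix e :: real assume e: "e > 0"
  define d where "d = e / (3 * (L + 1))"
  have d: "d > 0" "L * d < e / 3"
    unfolding d_def using e assms(3) by (auto simp: field_simps)
  obtain X where X: "finite X" "K \<subseteq> (\<Union>x\<in>X. ball x d)"
    using assms(1) d(1) unfolding compact_eq_totally_bounded by blast
  have "\<forall>\<^sub>F s in \<FF>. \<forall>x\<in>X. dist (F s x) (F' x) < e / 3"
    using X(1) e by (intro eventually_ball_finite ballI tendstoD assms(2)) auto
  then show "\<forall>\<^sub>F s in \<FF>. \<forall>k\<in>K. dist (F s k) (F' k) < e"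
  proof eventually_elim
    case (elim s)
    show ?case
    proof
      fix k assume "k \<in> K"
      then obtain x where x: "x \<in> X" "dist x k < d" using X(2) by auto
      have "L * dist x k < e / 3"
        using x(2) assms(3) d(2) by (meson le_less_trans less_imp_le mult_left_mono)
      then have "dist (F s x) (F s k) < e / 3" "dist (F' x) (F' k) < e / 3"
        using F[of s x k] F'[of x k] by auto
      moreover have "dist (F s x) (F' x) < e / 3" using elim x(1) by blast
      moreover have "dist (F s k) (F' k) \<le> dist (F s k) (F s x) + dist (F s x) (F' x) + dist (F' x) (F' k)"
        by (metis dist_triangle add.assoc add_left_mono order_trans)
      ultimately show "dist (F s k) (F' k) < e"
        by (simp add: dist_commute)
    qed
  qed
qed

section \<open>Trigonometric polynomials and weak convergence\<close>

text \<open>Frequencies range over all of \<open>real^'n\<close>, not over a lattice, so that all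
  points can be separated. There is no rule for products: closure under multiplication is derived,
  and inductions over the predicate only meet linear operations.\<close>

inductive trig_polynomial :: "(real^'n \<Rightarrow> real) \<Rightarrow> bool" where
  trig_cos: "trig_polynomial (\<lambda>x. cos (2 * pi * (k \<bullet> x)))"
| trig_sin: "trig_polynomial (\<lambda>x. sin (2 * pi * (k \<bullet> x)))"
| trig_add: "trig_polynomial p \<Longrightarrow> trig_polynomial q \<Longrightarrow> trig_polynomial (\<lambda>x. p x + q x)"
| trig_scale: "trig_polynomial p \<Longrightarrow> trig_polynomial (\<lambda>x. c * p x)"

lemma trig_polynomial_continuous: "trig_polynomial p \<Longrightarrow> continuous_on S p"
  by (induction rule: trig_polynomial.induct) (intro continuous_intros; assumption)+

lemma trig_polynomial_const: "trig_polynomial (\<lambda>x. c)"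
  using trig_scale[OF trig_cos[of 0], of c] by simp

text \<open>The product-to-sum formulas turn products of sines and cosines into combinations with
  the frequencies \<open>k + l\<close> and \<open>k - l\<close>.\<close>

lemma trig_polynomial_mult_base:
  assumes "trig_polynomial q"
  shows "trig_polynomial (\<lambda>x. cos (2 * pi * (k \<bullet> x)) * q x)" "trig_polynomial (\<lambda>x. sin (2 * pi * (k \<bullet> x)) * q x)"
  using assms
proof (induction rule: trig_polynomial.induct)
  case (trig_cos l)
  have "(\<lambda>x. cos (2 * pi * (k \<bullet> x)) * cos (2 * pi * (l \<bullet> x)))
     = (\<lambda>x. 1/2 * (cos (2 * pi * ((k - l) \<bullet> x)) + cos (2 * pi * ((k + l) \<bullet> x))))"
    by (simp add: fun_eq_iff cos_times_cos inner_diff_left inner_add_left distrib_left right_diff_distrib)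
  then show "trig_polynomial (\<lambda>x. cos (2 * pi * (k \<bullet> x)) * cos (2 * pi * (l \<bullet> x)))"
    by (simp only:) (intro trig_polynomial.intros)
  have "(\<lambda>x. sin (2 * pi * (k \<bullet> x)) * cos (2 * pi * (l \<bullet> x)))
     = (\<lambda>x. 1/2 * (sin (2 * pi * ((k + l) \<bullet> x)) + sin (2 * pi * ((k - l) \<bullet> x))))"
    by (simp add: fun_eq_iff sin_times_cos inner_diff_left inner_add_left distrib_left right_diff_distrib)
  then show "trig_polynomial (\<lambda>x. sin (2 * pi * (k \<bullet> x)) * cos (2 * pi * (l \<bullet> x)))"
    by (simp only:) (intro trig_polynomial.intros)
next
  case (trig_sin l)
  have "(\<lambda>x. cos (2 * pi * (k \<bullet> x)) * sin (2 * pi * (l \<bullet> x)))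
     = (\<lambda>x. 1/2 * (sin (2 * pi * ((k + l) \<bullet> x)) + (-1) * sin (2 * pi * ((k - l) \<bullet> x))))"
    by (simp add: fun_eq_iff cos_times_sin inner_diff_left inner_add_left distrib_left right_diff_distrib)
  then show "trig_polynomial (\<lambda>x. cos (2 * pi * (k \<bullet> x)) * sin (2 * pi * (l \<bullet> x)))"
    by (simp only:) (intro trig_polynomial.intros)
  have "(\<lambda>x. sin (2 * pi * (k \<bullet> x)) * sin (2 * pi * (l \<bullet> x)))
     = (\<lambda>x. 1/2 * (cos (2 * pi * ((k - l) \<bullet> x)) + (-1) * cos (2 * pi * ((k + l) \<bullet> x))))"
    by (simp add: fun_eq_iff sin_times_sin inner_diff_left inner_add_left distrib_left right_diff_distrib)
  then show "trig_polynomial (\<lambda>x. sin (2 * pi * (k \<bullet> x)) * sin (2 * pi * (l \<bullet> x)))"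
    by (simp only:) (intro trig_polynomial.intros)
next
  case (trig_add p q)
  then show "trig_polynomial (\<lambda>x. cos (2 * pi * (k \<bullet> x)) * (p x + q x))" "trig_polynomial (\<lambda>x. sin (2 * pi * (k \<bullet> x)) * (p x + q x))"
    by (simp_all only: distrib_left) (intro trig_polynomial.trig_add; assumption)+
next
  case (trig_scale p c)
  then show "trig_polynomial (\<lambda>x. cos (2 * pi * (k \<bullet> x)) * (c * p x))" "trig_polynomial (\<lambda>x. sin (2 * pi * (k \<bullet> x)) * (c * p x))"
    by (simp_all only: mult.left_commute[of _ c]) (intro trig_polynomial.trig_scale; assumption)+
qed

lemma trig_polynomial_mult:
  assumes "trig_polynomial p" "trig_polynomial q"
  shows "trig_polynomial (\<lambda>x. p x * q x)"
  using assms(1)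
proof (induction rule: trig_polynomial.induct)
  case (trig_add p\<^sub>1 p\<^sub>2)
  then show ?case by (simp only: distrib_right) (rule trig_polynomial.trig_add)
next
  case (trig_scale p c)
  then show ?case by (simp only: mult.assoc) (rule trig_polynomial.trig_scale)
qed (rule trig_polynomial_mult_base[OF assms(2)])+

text \<open>The frequency along \<open>x - y\<close> is scaled so that the two phases differ by
  exactly \<open>pi\<close>. Sine and cosine then both change sign, and they are never zero
  together.\<close>

lemma trig_polynomial_separates:
  assumes "x \<noteq> y"
  obtains p where "trig_polynomial p" "p x \<noteq> p y"
proof -
  define k where "k = (1 / (2 * (norm (x - y))\<^sup>2)) *\<^sub>R (x - y)"
  have "k \<bullet> x = k \<bullet> y + 1 / 2"
  proof -
    have "k \<bullet> (x - y) = 1 / 2"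
      unfolding k_def using assms by (simp add: power2_norm_eq_inner)
    then show ?thesis by (simp add: inner_diff_right)
  qed
  then have *: "2 * pi * (k \<bullet> x) = 2 * pi * (k \<bullet> y) + pi"
    by (simp add: algebra_simps)
  have "cos (2 * pi * (k \<bullet> x)) \<noteq> cos (2 * pi * (k \<bullet> y)) \<or> sin (2 * pi * (k \<bullet> x)) \<noteq> sin (2 * pi * (k \<bullet> y))"
    unfolding * using sin_zero_abs_cos_one[of "2 * pi * (k \<bullet> y)"] by auto
  then show ?thesis
    using that[OF trig_cos[of k]] that[OF trig_sin[of k]] by blast
qed

lemma trig_polynomial_dense:
  fixes \<phi> :: "real^'n \<Rightarrow> real"
  assumes "compact \<Omega>" "continuous_on \<Omega> \<phi>" "e > 0"
  obtains p where "trig_polynomial p" "\<And>x. x \<in> \<Omega> \<Longrightarrow> \<bar>\<phi> x - p x\<bar> < e"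
proof -
  interpret function_ring_on "Collect trig_polynomial" \<Omega>
  proof unfold_locales
    fix x y :: "real^'n" assume "x \<noteq> y"
    then show "\<exists>p\<in>Collect trig_polynomial. p x \<noteq> p y"
      using trig_polynomial_separates by (metis mem_Collect_eq)
  qed (simp_all add: assms(1) trig_polynomial_continuous trig_polynomial_const trig_add trig_polynomial_mult)
  obtain p where "p \<in> Collect trig_polynomial" "\<forall>x\<in>\<Omega>. \<bar>\<phi> x - p x\<bar> < e"
    using Stone_Weierstrass_basic[OF assms(2,3)] by blast
  then show ?thesis by (intro that) auto
qed

lemma fourier_imp_weak_convergence:
  fixes \<mu> :: "'s \<Rightarrow> (real^'n) measure" and \<phi> :: "real^'n \<Rightarrow> real"
  assumes \<Omega>: "compact \<Omega>" and \<mu>: "\<And>s. prob_on \<Omega> (\<mu> s)" and \<nu>: "prob_on \<Omega> \<nu>"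
    and lim: "\<And>k. ((\<lambda>s. fourier (\<mu> s) k) \<longlongrightarrow> fourier \<nu> k) \<FF>"
    and \<phi>: "continuous_on UNIV \<phi>"
  shows "((\<lambda>s. LINT x|\<mu> s. \<phi> x) \<longlongrightarrow> (LINT x|\<nu>. \<phi> x)) \<FF>"
proof -
  have \<Omega>': "\<Omega> \<in> sets borel" using compact_imp_closed[OF \<Omega>] by auto
  have int: "integrable M h" if "prob_on \<Omega> M" "continuous_on UNIV h" for M and h :: "real^'n \<Rightarrow> real"
  proof -
    have "compact (h ` \<Omega>)"
      using \<Omega> that(2) by (intro compact_continuous_image) (auto intro: continuous_on_subset)
    then obtain C where C: "\<forall>y\<in>h ` \<Omega>. norm y \<le> C"
      using bounded_iff[THEN iffD1, OF compact_imp_bounded] by blast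
    show ?thesis
      using C by (intro prob_on_integrable[OF that(1) \<Omega>' borel_measurable_continuous_onI[OF that(2)], of C]) blast
  qed
  have char: "integrable M (character k)" if "prob_on \<Omega> M" for M k
    by (rule prob_on_integrable[OF that \<Omega>' character_measurable, where C=1]) simp
  \<comment> \<open>Cosine and sine integrate to the real part and the negated imaginary part of the
    transform, so pointwise convergence of transforms is all that enters.\<close>
  have trig: "((\<lambda>s. LINT x|\<mu> s. p x) \<longlongrightarrow> (LINT x|\<nu>. p x)) \<FF>" if "trig_polynomial p" for p
    using that
  proof (induction rule: trig_polynomial.induct)
    case (trig_cos k)
    have "(LINT x|M. cos (2 * pi * (k \<bullet> x))) = Re (fourier M k)" if "prob_on \<Omega> M" for M
      unfolding fourier_character integral_Re[OF char[OF that], symmetric] Re_character ..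
    then show ?case using tendsto_Re[OF lim[of k]] \<mu> \<nu> by simp
  next
    case (trig_sin k)
    have "(LINT x|M. sin (2 * pi * (k \<bullet> x))) = - Im (fourier M k)" if "prob_on \<Omega> M" for M
      unfolding fourier_character integral_Im[OF char[OF that], symmetric] Im_character by simp
    then show ?case using tendsto_minus[OF tendsto_Im[OF lim[of k]]] \<mu> \<nu> by simp
  next
    case (trig_add p q)
    have "(LINT x|M. p x + q x) = (LINT x|M. p x) + (LINT x|M. q x)" if "prob_on \<Omega> M" for M
      using trig_add.hyps by (intro Bochner_Integration.integral_add int that trig_polynomial_continuous)
    then show ?case using tendsto_add[OF trig_add.IH] \<mu> \<nu> by simp
  next
    case (trig_scale p c)
    then show ?case by (simp add: tendsto_mult_left)
  qed
  show ?thesis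
  proof (rule tendstoI)
    fix e :: real assume e: "e > 0"
    obtain p where p: "trig_polynomial p" "\<And>x. x \<in> \<Omega> \<Longrightarrow> \<bar>\<phi> x - p x\<bar> < e / 3"
      using trig_polynomial_dense[OF \<Omega> continuous_on_subset[OF \<phi> subset_UNIV], of "e / 3"] e by auto
    have cont: "continuous_on UNIV p" using p(1) by (rule trig_polynomial_continuous)
    \<comment> \<open>The approximation of \<open>\<phi>\<close> by \<open>p\<close> holds only on
      \<open>\<Omega>\<close>; as the measures are probabilities carried by \<open>\<Omega>\<close>,
      the integration error is uniform in \<open>s\<close>.\<close>
    have close: "\<bar>(LINT x|M. \<phi> x) - (LINT x|M. p x)\<bar> \<le> e / 3" if "prob_on \<Omega> M" for M
    proof -
      have "(LINT x|M. \<phi> x) - (LINT x|M. p x) = (LINT x|M. \<phi> x - p x)"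
        by (intro Bochner_Integration.integral_diff[symmetric] int that \<phi> cont)
      moreover have "norm (LINT x|M. \<phi> x - p x) \<le> e / 3"
        by (rule prob_on_integral_norm_le[OF that \<Omega>'])
           (use p(2) \<phi> cont in \<open>auto intro!: borel_measurable_continuous_onI continuous_intros less_imp_le\<close>)
      ultimately show ?thesis by simp
    qed
    have "\<forall>\<^sub>F s in \<FF>. dist (LINT x|\<mu> s. p x) (LINT x|\<nu>. p x) < e / 3"
      using trig[OF p(1)] e by (intro tendstoD) auto
    then show "\<forall>\<^sub>F s in \<FF>. dist (LINT x|\<mu> s. \<phi> x) (LINT x|\<nu>. \<phi> x) < e"
    proof eventually_elim
      case (elim s)
      then show ?case
        using close[OF \<mu>[of s]] close[OF \<nu>] unfolding dist_real_def by linarith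
    qed
  qed
qed

theorem proposition5:
  fixes \<Gamma> :: "((real^'m) \<times> (real^'n)) set"
    and \<Omega> :: "(real^'n) set"
    and Q :: "real^'m \<Rightarrow> real^'m"
    and A :: "real^'n \<Rightarrow> real^'n"
    and f :: "real^'n \<Rightarrow> real"
    and \<mu> :: "real \<Rightarrow> (real^'n) measure"
  assumes "cut_and_project \<Gamma>"
    and "model_set_window \<Omega>"
    and "0 \<in> Lam \<Gamma> \<Omega>" and "0 \<in> interior \<Omega>"
    and "linear_similarity Q" and "Q ` phys \<Gamma> = phys \<Gamma>"
    and "internal_map \<Gamma> Q A"
    and "A ` \<Omega> \<subseteq> \<Omega>"
    and "complex_diagonalizable A"
    and "\<And>c. complex_eigenvalue A c \<Longrightarrow> cmod c < 1"
    and "compatible A \<Omega>"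
    and "frontier (Omega_Q A \<Omega>) \<in> null_sets lborel"
    and "invariant_density A \<Omega> f"
    and "\<And>s. s > 0 \<Longrightarrow> hutchinson_measure \<Gamma> A \<Omega> s (\<mu> s)"
  shows
    "(\<forall>s>0. \<forall>k. (\<lambda>N. g_fun \<Gamma> A \<Omega> s ((adjoint A ^^ N) k)) has_prod fourier (\<mu> s) k) \<and>
     (\<forall>K. compact K \<longrightarrow>
        uniform_limit K (\<lambda>s. fourier (\<mu> s)) (fourier (density_measure f)) at_top) \<and>
     (\<forall>\<phi>\<in>C_space \<Omega>.
        ((\<lambda>s. LINT x|\<mu> s. \<phi> x) \<longlongrightarrow> (LINT x|density_measure f. \<phi> x)) at_top)"
proof -
  note cp = assms(1)
  have A: "linear A" using assms(7) by (simp add: internal_map_def)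
  have bij: "bij A" by (rule bij_internal_map[OF cp assms(7,6)])
  have \<Omega>: "compact \<Omega>" using assms(2) by (simp add: model_set_window_def)
  have ne: "\<Omega> \<noteq> {}" using assms(4) interior_subset by blast
  have U: "compact (Omega_Q A \<Omega>)" "interior (Omega_Q A \<Omega>) \<noteq> {}" "frontier (Omega_Q A \<Omega>) \<in> null_sets lborel"
    using compact_Omega_Q[OF \<Omega> ne] assms(11,12) by (simp_all add: compatible_def)
  have \<Omega>': "\<Omega> \<in> sets borel" using compact_imp_closed[OF \<Omega>] by auto
  define \<nu> where "\<nu> = density_measure f"
  have \<nu>: "prob_on \<Omega> \<nu>" unfolding \<nu>_def by (rule density_prob_on[OF A bij \<Omega> U(1) assms(13)])
  have \<mu>: "prob_on \<Omega> (\<mu> s)" if "s > 0" for s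
    using hutchinson_prob_on[OF assms(14)[OF that] \<Omega>'] .
  obtain R\<^sub>1 where R\<^sub>1: "\<forall>x\<in>\<Omega>. norm x \<le> R\<^sub>1"
    using bounded_iff[THEN iffD1, OF compact_imp_bounded[OF \<Omega>]] by blast
  obtain R\<^sub>2 where R\<^sub>2: "\<forall>x\<in>Omega_Q A \<Omega>. norm x \<le> R\<^sub>2"
    using bounded_iff[THEN iffD1, OF compact_imp_bounded[OF U(1)]] by blast
  \<comment> \<open>One radius for both windows: \<open>\<Omega>\<close> controls the transforms of
    the measures, \<open>Omega_Q\<close> the star images entering \<open>g_fun\<close>. This yields
    the common constant \<open>L\<close>.\<close>
  define R where "R = \<bar>R\<^sub>1\<bar> + \<bar>R\<^sub>2\<bar>"
  have R: "R \<ge> 0" "x \<in> \<Omega> \<Longrightarrow> norm x \<le> R" "x \<in> Omega_Q A \<Omega> \<Longrightarrow> norm x \<le> R" for x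
    using R\<^sub>1 R\<^sub>2 unfolding R_def by force+
  have T: "finite (T_set \<Gamma> A \<Omega> s)" "T_set \<Gamma> A \<Omega> s \<noteq> {}" if "s > 0" for s
    using finite_T_set[OF cp U(1)] zero_in_T_set[OF cp assms(8) that] by auto
  define L where "L = 2 * pi * R"
  have L: "L \<ge> 0" unfolding L_def using R(1) by simp
  have Lip: "norm (fourier M k - fourier M l) \<le> L * norm (k - l)" if "prob_on \<Omega> M" for M k l
    unfolding L_def by (rule fourier_Lipschitz[OF that \<Omega>' R(2)])
  have F1: "norm (fourier M k - 1) \<le> L * norm k" if "prob_on \<Omega> M" for M k
    using Lip[OF that, of k 0] fourier_0[OF that] by simp
  have ref: "fourier (\<mu> s) k = g_fun \<Gamma> A \<Omega> s k * fourier (\<mu> s) (adjoint A k)" if "s > 0" for s k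
    by (rule hutchinson_fourier[OF assms(14)[OF that] \<Omega>' A T[OF that]])
  have g1: "norm (g_fun \<Gamma> A \<Omega> s k - 1) \<le> L * norm k" if "s > 0" for s k
    unfolding L_def
  proof (rule norm_g_fun_minus_1_le[OF T[OF that]])
    show "norm (star \<Gamma> v) \<le> R" if "v \<in> T_set \<Gamma> A \<Omega> s" for v
      using that by (intro R(3)) (simp add: T_set_def Lam_def)
  qed
  have sum: "summable (\<lambda>N. norm ((adjoint A ^^ N) k))" for k
    using adjoint_power_summable[OF A assms(9,10)] .

  have prod: "(\<lambda>N. g_fun \<Gamma> A \<Omega> s ((adjoint A ^^ N) k)) has_prod fourier (\<mu> s) k" if "s > 0" for s k
    by (rule refinement_has_prod[OF ref[OF that] g1[OF that] F1[OF \<mu>[OF that]] sum])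

  text \<open>Only \<open>s > 0\<close> is controlled, so the family is extended constantly to the other parameters.\<close>
  define c where "c s = (if s > 0 then s else 1)" for s :: real
  have c: "c s > 0" for s unfolding c_def by simp
  have c_eq: "\<forall>\<^sub>F s in at_top. c s = s"
    using eventually_gt_at_top[of 0] by eventually_elim (simp add: c_def)
  have g_lim: "((\<lambda>s. g_fun \<Gamma> A \<Omega> (c s) k) \<longlongrightarrow> window_transform (Omega_Q A \<Omega>) k) at_top" for k
  proof (rule Lim_transform_eventually[OF g_fun_tendsto[OF cp U]])
    show "\<forall>\<^sub>F s in at_top. g_fun \<Gamma> A \<Omega> s k = g_fun \<Gamma> A \<Omega> (c s) k"
      using c_eq by eventually_elim simp
  qed
  have lim: "((\<lambda>s. fourier (\<mu> (c s)) k) \<longlongrightarrow> fourier \<nu> k) at_top" for k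
  proof (rule refinement_tendsto[where F="\<lambda>s. fourier (\<mu> (c s))" and g="\<lambda>s. g_fun \<Gamma> A \<Omega> (c s)"
        and F'="fourier \<nu>" and g'="window_transform (Omega_Q A \<Omega>)" and B="adjoint A" and L=L])
    show "fourier \<nu> k = window_transform (Omega_Q A \<Omega>) k * fourier \<nu> (adjoint A k)" for k
      unfolding \<nu>_def by (rule density_fourier_scaling[OF A bij \<Omega> U(1) assms(13)])
    show "(\<lambda>N. norm ((adjoint A ^^ N) k)) \<longlonglongrightarrow> 0"
      using sum by (rule summable_LIMSEQ_zero)
    show "((\<lambda>s. g_fun \<Gamma> A \<Omega> (c s) k) \<longlongrightarrow> window_transform (Omega_Q A \<Omega>) k) at_top" for k
      by (rule g_lim)
    show "fourier (\<mu> (c s)) k = g_fun \<Gamma> A \<Omega> (c s) k * fourier (\<mu> (c s)) (adjoint A k)" for s k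
      by (rule ref[OF c])
  qed (simp_all add: F1 \<mu> \<nu> c norm_g_fun_le)
  have uniform: "uniform_limit K (\<lambda>s. fourier (\<mu> s)) (fourier \<nu>) at_top" if "compact K" for K
  proof (rule uniform_limit_cong[THEN iffD1])
    show "uniform_limit K (\<lambda>s. fourier (\<mu> (c s))) (fourier \<nu>) at_top"
      by (rule uniform_limit_Lipschitz[OF that lim L])
         (simp_all add: dist_norm Lip \<mu> \<nu> c)
    show "\<forall>\<^sub>F s in at_top. \<forall>k\<in>K. fourier (\<mu> (c s)) k = fourier (\<mu> s) k"
      using c_eq by eventually_elim simp
  qed simp
  have weak: "((\<lambda>s. LINT x|\<mu> s. \<phi> x) \<longlongrightarrow> (LINT x|\<nu>. \<phi> x)) at_top" if "\<phi> \<in> C_space \<Omega>" for \<phi>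
  proof -
    have cont: "continuous_on UNIV \<phi>" using that by (simp add: C_space_def)
    have int: "integrable M \<phi>" if "prob_on \<Omega> M" for M
    proof -
      obtain C where "\<forall>y\<in>\<phi> ` \<Omega>. norm y \<le> C"
        using compact_imp_bounded[OF compact_continuous_image[OF continuous_on_subset[OF cont subset_UNIV] \<Omega>]]
        unfolding bounded_iff by blast
      then show ?thesis
        by (intro prob_on_integrable[OF that \<Omega>' borel_measurable_continuous_onI[OF cont], of C]) blast
    qed
    \<comment> \<open>Uniform approximation by trigonometric polynomials was set up for real
      functions, so the complex test function is treated by real and imaginary parts.\<close>
    have "((\<lambda>s. LINT x|\<mu> (c s). Re (\<phi> x)) \<longlongrightarrow> (LINT x|\<nu>. Re (\<phi> x))) at_top"
      "((\<lambda>s. LINT x|\<mu> (c s). Im (\<phi> x)) \<longlongrightarrow> (LINT x|\<nu>. Im (\<phi> x))) at_top"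
      by (intro fourier_imp_weak_convergence[OF \<Omega> _ \<nu> lim] \<mu> c continuous_on_Re continuous_on_Im cont)+
    then have "((\<lambda>s. LINT x|\<mu> (c s). \<phi> x) \<longlongrightarrow> (LINT x|\<nu>. \<phi> x)) at_top"
      by (simp add: tendsto_complex_iff integral_Re[OF int] integral_Im[OF int] \<mu> \<nu> c)
    then show ?thesis
      by (rule Lim_transform_eventually) (use c_eq in eventually_elim, simp)
  qed
  show ?thesis
    using prod uniform weak unfolding \<nu>_def by blast
qed

end
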